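(* Let $\{X(t),t\in\mathbb{Z}\}$ be a linear time series with $\operatorname{E}|X(0)|^3<\infty$ whose spectral density is positive almost everywhere on $[0,2\pi)$. If its bispectrum is real-valued but not almost everywhere zero, then $\{X(t),t\in\mathbb{Z}\}$ is reversible.
   Context: A time series $\{X(t),t\in\mathbb{Z}\}$ is linear if it has a moving average representation $X(t)=\sum_{k=-\infty}^{\infty}c(k)Z(t-k)$ with $\sum_k c(k)^2<\infty$, where the random variables $Z(t)$, $t\in\mathbb{Z}$, are i.i.d. with $\operatorname{E}Z(t)=0$, $\operatorname{E}Z(t)^2<\infty$. It is reversible if $(X_t,X_{t+1},\dots,X_{t+k})$ and $(X_{t+k},X_{t+k-1},\dots,X_t)$ have the same distribution for all $k\in\mathbb{N}$, $t\in\mathbb{Z}$. For a stationary time series with finite third absolute moment, a function $B(\omega_1,\omega_2)$ defined a.e. on $[0,2\pi)\times[0,2\pi)$ is called the bispectrum if $B$ is Lebesgue integrable and $\operatorname{cum}(X(0),X(t_1),X(t_2))=\int_0^{2\pi}\int_0^{2\pi}\exp(i(t_1\omega_1+t_2\omega_2))B(\omega_1,\omega_2)\,d\omega_1d\omega_2$ for all $t_1,t_2\in\mathbb{Z}$, where $\operatorname{cum}$ denotes the joint third-order cumulant. *)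

theory Defs
  imports "HOL-Probability.Probability"
begin

definition linear_ts :: "'a measure \<Rightarrow> (int \<Rightarrow> 'a \<Rightarrow> real) \<Rightarrow> bool" where
  "linear_ts M X \<longleftrightarrow>
     (\<forall>t. X t \<in> borel_measurable M) \<and>
     (\<exists>(c::int \<Rightarrow> real) (Z::int \<Rightarrow> 'a \<Rightarrow> real).
        (\<lambda>k. (c k)\<^sup>2) summable_on UNIV \<and>
        prob_space.indep_vars M (\<lambda>_. borel) Z UNIV \<and>
        (\<forall>t. distr M borel (Z t) = distr M borel (Z 0)) \<and>
        integrable M (\<lambda>\<omega>. (Z 0 \<omega>)\<^sup>2) \<and>
        integral\<^sup>L M (Z 0) = 0 \<and>
        (\<forall>t. AE \<omega> in M.
           (\<lambda>n. \<Sum>k\<in>{- int n..int n}. c k * Z (t - k) \<omega>) \<longlonglongrightarrow> X t \<omega>))"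

definition reversible :: "'a measure \<Rightarrow> (int \<Rightarrow> 'a \<Rightarrow> real) \<Rightarrow> bool" where
  "reversible M X \<longleftrightarrow>
     (\<forall>(k::nat) (t::int).
        distr M (PiM {..k} (\<lambda>_. borel)) (\<lambda>\<omega>. \<lambda>i\<in>{..k}. X (t + int i) \<omega>) =
        distr M (PiM {..k} (\<lambda>_. borel)) (\<lambda>\<omega>. \<lambda>i\<in>{..k}. X (t + int k - int i) \<omega>))"

definition cov2 :: "'a measure \<Rightarrow> ('a \<Rightarrow> real) \<Rightarrow> ('a \<Rightarrow> real) \<Rightarrow> real" where
  "cov2 M U V = integral\<^sup>L M (\<lambda>\<omega>. (U \<omega> - integral\<^sup>L M U) * (V \<omega> - integral\<^sup>L M V))"

definition cum3 :: "'a measure \<Rightarrow> ('a \<Rightarrow> real) \<Rightarrow> ('a \<Rightarrow> real) \<Rightarrow> ('a \<Rightarrow> real) \<Rightarrow> real" where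
  "cum3 M U V W = integral\<^sup>L M (\<lambda>\<omega>. (U \<omega> - integral\<^sup>L M U) * (V \<omega> - integral\<^sup>L M V)
                                        * (W \<omega> - integral\<^sup>L M W))"

definition is_spectral_density :: "'a measure \<Rightarrow> (int \<Rightarrow> 'a \<Rightarrow> real) \<Rightarrow> (real \<Rightarrow> real) \<Rightarrow> bool" where
  "is_spectral_density M X f \<longleftrightarrow>
     set_integrable lborel {0..<2*pi} f \<and>
     (\<forall>t::int. complex_of_real (cov2 M (X 0) (X t)) =
        (LINT w:{0..<2*pi}|lborel. exp (\<i> * (of_int t * complex_of_real w)) * complex_of_real (f w)))"

definition is_bispectrum :: "'a measure \<Rightarrow> (int \<Rightarrow> 'a \<Rightarrow> real) \<Rightarrow> (real \<times> real \<Rightarrow> complex) \<Rightarrow> bool" where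
  "is_bispectrum M X B \<longleftrightarrow>
     set_integrable lborel ({0..<2*pi} \<times> {0..<2*pi}) B \<and>
     (\<forall>t1 t2 :: int. complex_of_real (cum3 M (X 0) (X t1) (X t2)) =
        (LINT w:{0..<2*pi} \<times> {0..<2*pi}|lborel.
           exp (\<i> * (of_int t1 * complex_of_real (fst w) + of_int t2 * complex_of_real (snd w))) * B w))"

end

theory Submission
  imports Defs
begin

text \<open>
  Write $C$ for the Fourier series of the coefficients $c$. Moments of order two and three of $X$
  are limits of those of finite partial sums, so the spectral density is a multiple of $|C|^2$ and the
  third cumulants are $\kappa$ times the triple correlations $T(t,s) = \sum_j c(j)c(j+t)c(j+s)$.
  A real bispectrum says $T(-t,-s) = T(t,s)$: the sequence $c$ and its reflection $d(k) = c(-k)$ have the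
  same triple correlations.

  Instead of solving the functional equation of a measurable character, let
  $u = \overline{C}/C$ with Fourier coefficients $U$. Applying uniqueness of Fourier
  coefficients to the identity $T_c = T_d$ in the variable $s$ gives
  $d(k)d(k+t) = \sum_j c(j)c(j+t)U(k-j)$; applying it once more in the variable $t$ gives
  $c(j)U(k-j) = d(k)U(k-j)$. Any $m$ with $U(m) \neq 0$ then yields $c(k-m) = c(-k)$ for all $k$, and
  replacing the innovations $Z(s)$ by $Z(a-s)$ reverses time without changing the law.
\<close>

section \<open>Uniqueness of Fourier coefficients on the circle\<close>

text \<open>Two obstacles shape the proof. In the frequency domain the triple correlation involves C
  at the sum of two frequencies, a genuinely two-dimensional object. Freezing one lag avoids this: c
  is bounded, so c(j) c(j+t) is again square summable in j, and what remains are products of two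
  square-integrable functions of one variable, to which uniqueness for integrable functions on the
  circle applies. The second obstacle is the mode of convergence. The series for X(t) is given to
  converge almost surely along windows centred at 0, whereas reflection moves the centre of the
  window, and moments call for convergence in mean. Both points are settled by approximation in
  third mean along arbitrary finite windows. It rests on bounding third absolute moments of finite
  sums by a multiple of the sum of squared coefficients, and this uses a third moment of Z, which
  has to be extracted from that of X. Positivity of the spectral density permits division by C; a
  bispectrum that is not almost everywhere zero makes kappa nonzero, so that cumulants can be
  divided by it.\<close>

definition circ :: "real measure" where
  "circ = density lborel (\<lambda>x. ennreal (indicator {0..<2*pi} x / (2*pi)))"

definition ech :: "int \<Rightarrow> real \<Rightarrow> complex" where
  "ech k x = cis (of_int k * x)"

lemma ech_add: "ech (j + k) x = ech j x * ech k x"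
  by (simp add: ech_def cis_mult algebra_simps)

lemma ech_uminus: "ech (- k) x = cnj (ech k x)"
  by (simp add: ech_def cis_cnj)

lemma ech_0 [simp]: "ech 0 x = 1"
  by (simp add: ech_def)

lemma norm_ech [simp]: "cmod (ech k x) = 1"
  by (simp add: ech_def)

lemma borel_measurable_ech [measurable]: "ech k \<in> borel_measurable borel"
  unfolding ech_def by (intro borel_measurable_continuous_onI continuous_intros)

lemma space_circ [simp]: "space circ = UNIV"
  by (simp add: circ_def)

lemma sets_circ [simp, measurable_cong]: "sets circ = sets borel"
  by (simp add: circ_def)

lemma integral_circ:
  fixes g :: "real \<Rightarrow> 'b :: {banach, second_countable_topology}"
  assumes [measurable]: "g \<in> borel_measurable borel"
  shows "integral\<^sup>L circ g = (LINT x:{0..<2*pi}|lborel. g x) /\<^sub>R (2*pi)"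
proof -
  have "integral\<^sup>L circ g = (\<integral>x. (indicator {0..<2*pi} x / (2*pi)) *\<^sub>R g x \<partial>lborel)"
    unfolding circ_def by (rule integral_density) auto
  also have "\<dots> = (\<integral>x. inverse (2*pi) *\<^sub>R (indicator {0..<2*pi} x *\<^sub>R g x) \<partial>lborel)"
    by (rule Bochner_Integration.integral_cong) (auto simp: field_simps)
  also have "\<dots> = (LINT x:{0..<2*pi}|lborel. g x) /\<^sub>R (2*pi)"
    unfolding set_lebesgue_integral_def by (rule integral_scaleR_right)
  finally show ?thesis .
qed

lemma integrable_circ_iff:
  fixes g :: "real \<Rightarrow> 'b :: {banach, second_countable_topology}"
  assumes [measurable]: "g \<in> borel_measurable borel"
  shows "integrable circ g \<longleftrightarrow> set_integrable lborel {0..<2*pi} g"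
proof -
  have "integrable circ g \<longleftrightarrow> integrable lborel (\<lambda>x. (indicator {0..<2*pi} x / (2*pi)) *\<^sub>R g x)"
    unfolding circ_def by (rule integrable_density) auto
  also have "(\<lambda>x. (indicator {0..<2*pi} x / (2*pi)) *\<^sub>R g x) =
      (\<lambda>x. inverse (2*pi) *\<^sub>R (indicator {0..<2*pi} x *\<^sub>R g x))"
    by (auto simp: field_simps)
  also have "integrable lborel \<dots> \<longleftrightarrow> integrable lborel (\<lambda>x. indicator {0..<2*pi} x *\<^sub>R g x)"
    (is "integrable lborel ?f \<longleftrightarrow> integrable lborel ?g")
  proof
    assume "integrable lborel ?f"
    then have "integrable lborel (\<lambda>x. (2*pi) *\<^sub>R ?f x)" by (rule integrable_scaleR_right)
    also have "(\<lambda>x. (2*pi) *\<^sub>R ?f x) = ?g" by (auto simp: fun_eq_iff)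
    finally show "integrable lborel ?g" .
  qed (intro integrable_scaleR_right)
  finally show ?thesis by (simp add: set_integrable_def)
qed

lemma AE_circ_iff: "(AE x in circ. P x) \<longleftrightarrow> (AE x in lborel. x \<in> {0..<2*pi} \<longrightarrow> P x)"
  unfolding circ_def by (subst AE_density) (auto intro!: AE_cong simp: indicator_def)

lemma AE_circ_interior: "AE x in circ. 0 < x \<and> x < 2*pi"
proof -
  have "AE x in lborel. x \<noteq> (0::real)" by (rule AE_lborel_singleton)
  then show ?thesis by (auto simp: AE_circ_iff)
qed

interpretation circ: prob_space circ
proof
  have "emeasure circ (space circ) = (\<integral>\<^sup>+x. ennreal (1/(2*pi)) * indicator {0..<2*pi} x \<partial>lborel)"
    by (auto simp: circ_def emeasure_density intro!: nn_integral_cong split: split_indicator)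
  also have "\<dots> = ennreal (1/(2*pi)) * ennreal (2*pi)"
    by (simp add: nn_integral_cmult)
  also have "\<dots> = 1" by (simp flip: ennreal_mult)
  finally show "emeasure circ (space circ) = 1" .
qed

lemma integral_ech: "integral\<^sup>L circ (ech k) = (if k = 0 then 1 else 0)"
proof (cases "k = 0")
  case True
  then have "ech k = (\<lambda>_. 1)" by (auto simp: fun_eq_iff)
  then show ?thesis using True circ.prob_space by simp
next
  case False
  define F where "F x = ech k x / (\<i> * of_int k)" for x
  have "(\<integral>x. indicator {0..2*pi} x *\<^sub>R ech k x \<partial>lborel) = F (2*pi) - F 0"
  proof (rule integral_FTC_Icc)
    fix x :: real
    show "(F has_vector_derivative ech k x) (at x within {0..2*pi})"
    proof -
      have "((\<lambda>z. exp (c * z)) has_field_derivative exp (c * w) * c) (at w)" for c w :: complex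
        by (auto intro!: derivative_eq_intros)
      from DERIV_cdivide[OF this[of "\<i> * of_int k" "of_real x"], of "\<i> * of_int k"]
      have "((\<lambda>z. exp (\<i> * (of_int k * z)) / (\<i> * of_int k)) has_field_derivative
          exp (\<i> * (of_int k * of_real x))) (at (of_real x))"
        using False by (simp only: mult.assoc) simp
      then show ?thesis
        unfolding F_def ech_def cis_conv_exp
        using has_vector_derivative_real_field by fastforce
    qed
  qed (auto simp: ech_def intro!: continuous_intros)
  also have "\<dots> = 0"
    using cis_multiple_2pi[of "of_int k"] by (simp add: F_def ech_def mult_ac)
  also have "(\<integral>x. indicator {0..2*pi} x *\<^sub>R ech k x \<partial>lborel) = (LINT x:{0..<2*pi}|lborel. ech k x)"
    unfolding set_lebesgue_integral_def
    by (rule integral_cong_AE) (use AE_lborel_singleton[of "2*pi"] in \<open>auto split: split_indicator\<close>)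
  finally show ?thesis using False by (simp add: integral_circ)
qed

section \<open>Integrable functions whose Fourier coefficients all vanish\<close>

lemma integrable_bounded_mult:
  fixes g h :: "'a \<Rightarrow> complex"
  assumes "integrable M h" "g \<in> borel_measurable M" "\<And>x. cmod (g x) \<le> C"
  shows "integrable M (\<lambda>x. g x * h x)"
proof (rule Bochner_Integration.integrable_bound[where f = "\<lambda>x. C * cmod (h x)"])
  show "AE x in M. norm (g x * h x) \<le> norm (C * cmod (h x))"
    using assms(3) order_trans[OF norm_ge_zero assms(3)]
    by (auto simp: norm_mult intro!: mult_right_mono)
qed (use assms in auto)

text \<open>Integrability is part of the class, which makes it a module over the trigonometric
  polynomials: multiplication by \<open>ech k\<close> merely shifts the index
  \<open>t\<close>.\<close>

definition vanishing_fc :: "(real \<Rightarrow> complex) \<Rightarrow> bool" where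
  "vanishing_fc h \<longleftrightarrow> integrable circ h \<and> (\<forall>t. (\<integral>x. ech t x * h x \<partial>circ) = 0)"

lemma vanishing_fc_ech_mult:
  assumes "vanishing_fc h" shows "vanishing_fc (\<lambda>x. ech k x * h x)"
proof -
  have "(\<integral>x. ech t x * (ech k x * h x) \<partial>circ) = (\<integral>x. ech (t + k) x * h x \<partial>circ)" for t
    by (simp add: ech_add mult.assoc)
  then show ?thesis using assms
    by (auto simp: vanishing_fc_def intro!: integrable_bounded_mult[where C=1])
qed

lemma vanishing_fc_add:
  assumes "vanishing_fc g" "vanishing_fc h" shows "vanishing_fc (\<lambda>x. g x + h x)"
proof -
  have "integrable circ (\<lambda>x. ech t x * g x)" "integrable circ (\<lambda>x. ech t x * h x)" for t
    using assms by (auto simp: vanishing_fc_def intro!: integrable_bounded_mult[where C=1])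
  then show ?thesis using assms by (simp add: vanishing_fc_def distrib_left)
qed

lemma vanishing_fc_cmult:
  assumes "vanishing_fc h" shows "vanishing_fc (\<lambda>x. c * h x)"
proof -
  have "(\<integral>x. ech t x * (c * h x) \<partial>circ) = c * (\<integral>x. ech t x * h x \<partial>circ)" for t
    by (simp flip: integral_mult_right_zero add: mult_ac)
  then show ?thesis using assms by (simp add: vanishing_fc_def)
qed

text \<open>Polynomials in the real and imaginary part of \<open>cis x\<close> are trigonometric
  polynomials. Only linear functionals carry content: by Euler's formulas they are combinations of
  \<open>ech 1\<close> and \<open>ech (-1)\<close>. Products use the induction hypothesis twice, the
  second time for the function produced by the first, hence the generalisation over
  \<open>h\<close>.\<close>

lemma vanishing_fc_polynomial:
  assumes "real_polynomial_function p" "vanishing_fc h"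
  shows "vanishing_fc (\<lambda>x. of_real (p (cis x)) * h x)"
  using assms
proof (induction arbitrary: h)
  case (linear f)
  interpret bounded_linear f by fact
  have f: "f z = Re z * f 1 + Im z * f \<i>" for z
  proof -
    have "f z = f (Re z *\<^sub>R 1 + Im z *\<^sub>R \<i>)" by (intro arg_cong[where f = f]) (simp add: complex_eq_iff)
    then show ?thesis by (simp only: add scaleR) simp
  qed
  have "of_real (f (cis x)) * h x =
     (f 1 / 2 + f \<i> / (2*\<i>)) * (ech 1 x * h x) + (f 1 / 2 - f \<i> / (2*\<i>)) * (ech (-1) x * h x)" for x
  proof -
    have cs: "of_real (cos x) = (ech 1 x + ech (-1) x) / 2" "of_real (sin x) = (ech 1 x - ech (-1) x) / (2*\<i>)"
      by (simp_all add: complex_eq_iff ech_def)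
    have fc: "complex_of_real (f (cis x)) = complex_of_real (cos x) * of_real (f 1) + complex_of_real (sin x) * of_real (f \<i>)"
      by (simp add: f[of "cis x"])
    show ?thesis unfolding fc cs by (simp add: algebra_simps add_divide_distrib diff_divide_distrib)
  qed
  then show ?case
    by (simp only:) (intro vanishing_fc_add vanishing_fc_cmult vanishing_fc_ech_mult linear.prems)
next
  case (const c)
  then show ?case by (rule vanishing_fc_cmult)
next
  case (add f g)
  then show ?case by (simp add: distrib_right vanishing_fc_add)
next
  case (mult f g)
  from mult.IH(1)[OF mult.IH(2)[OF mult.prems]] show ?case by (simp add: mult.assoc)
qed

text \<open>Stone-Weierstrass on the unit circle: replacing \<phi> by a polynomial within
  \<open>e\<close> changes the integral by at most \<open>e\<close> times the L1 norm of
  \<open>h\<close>. Test functions live on the plane and are composed with \<open>cis\<close>, so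
  periodicity is automatic.\<close>

lemma vanishing_fc_continuous:
  fixes \<phi> :: "complex \<Rightarrow> real"
  assumes "vanishing_fc h" "continuous_on UNIV \<phi>"
  shows "(\<integral>x. of_real (\<phi> (cis x)) * h x \<partial>circ) = 0"
proof -
  define I where "I = (\<integral>x. cmod (h x) \<partial>circ)"
  have h: "integrable circ h" using assms by (simp add: vanishing_fc_def)
  have "compact (\<phi> ` sphere 0 1)"
    by (intro compact_continuous_image continuous_on_subset[OF assms(2)]) auto
  then have "bounded (\<phi> ` sphere 0 1)" by (rule compact_imp_bounded)
  then obtain K where K: "\<And>z. z \<in> sphere 0 1 \<Longrightarrow> \<bar>\<phi> z\<bar> \<le> K"
    unfolding bounded_iff by fastforce
  have [measurable]: "\<phi> \<in> borel_measurable borel"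
    using assms(2) by (rule borel_measurable_continuous_onI)
  have [measurable]: "cis \<in> borel_measurable borel"
    by (intro borel_measurable_continuous_onI continuous_intros)
  have i1: "integrable circ (\<lambda>x. of_real (\<phi> (cis x)) * h x)"
    by (rule integrable_bounded_mult[OF h, where C = K]) (auto intro!: K)
  have bd: "cmod (\<integral>x. of_real (\<phi> (cis x)) * h x \<partial>circ) \<le> e * I" if "e > 0" for e
  proof -
    obtain p where p: "real_polynomial_function p" "\<And>z. z \<in> sphere 0 1 \<Longrightarrow> \<bar>\<phi> z - p z\<bar> < e"
      by (rule Stone_Weierstrass_real_polynomial_function[OF compact_sphere[of 0 1]
          continuous_on_subset[OF assms(2) subset_UNIV] \<open>e > 0\<close>]) (rule that)
    have v: "vanishing_fc (\<lambda>x. of_real (p (cis x)) * h x)"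
      by (rule vanishing_fc_polynomial) fact+
    then have i2: "integrable circ (\<lambda>x. of_real (p (cis x)) * h x)"
      and z: "(\<integral>x. of_real (p (cis x)) * h x \<partial>circ) = 0"
      using ech_0 by (auto simp: vanishing_fc_def dest: spec[of _ 0])
    have "(\<integral>x. of_real (\<phi> (cis x)) * h x \<partial>circ) =
        (\<integral>x. of_real (\<phi> (cis x)) * h x - of_real (p (cis x)) * h x \<partial>circ)"
      using i1 i2 z by simp
    also have "cmod \<dots> \<le> (\<integral>x. cmod (of_real (\<phi> (cis x)) * h x - of_real (p (cis x)) * h x) \<partial>circ)"
      by (rule integral_norm_bound)
    also have "\<dots> \<le> (\<integral>x. e * cmod (h x) \<partial>circ)"
    proof (rule integral_mono)
      show "cmod (of_real (\<phi> (cis x)) * h x - of_real (p (cis x)) * h x) \<le> e * cmod (h x)" for x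
      proof -
        have "\<bar>\<phi> (cis x) - p (cis x)\<bar> \<le> e" using p(2)[of "cis x"] by auto
        then have "cmod (of_real (\<phi> (cis x) - p (cis x)) * h x) \<le> e * cmod (h x)"
          unfolding norm_mult by (intro mult_right_mono) (simp_all only: norm_of_real norm_ge_zero)
        then show ?thesis by (simp add: left_diff_distrib)
      qed
    qed (use i1 i2 h in auto)
    finally show ?thesis by (simp add: I_def)
  qed
  have "I \<ge> 0" by (simp add: I_def)
  have "cmod (\<integral>x. of_real (\<phi> (cis x)) * h x \<partial>circ) \<le> 0 + e" if "e > 0" for e
  proof -
    \<comment> \<open>The denominator \<open>I + 1\<close> instead of \<open>I\<close> covers the
      case that the norm of \<open>h\<close> is zero.\<close>
    have "cmod (\<integral>x. of_real (\<phi> (cis x)) * h x \<partial>circ) \<le> e / (I + 1) * I"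
      using \<open>I \<ge> 0\<close> that by (intro bd) auto
    also have "\<dots> \<le> e" using \<open>I \<ge> 0\<close> that by (simp add: field_simps)
    finally show ?thesis by simp
  qed
  then have "cmod (\<integral>x. of_real (\<phi> (cis x)) * h x \<partial>circ) \<le> 0" by (rule field_le_epsilon)
  then show ?thesis by simp
qed

text \<open>The indicator of a closed set is the pointwise limit of continuous functions with values
  between 0 and 1 that fall off linearly, with slope \<open>n\<close>, in the distance to the set;
  \<open>cmod (h x)\<close> dominates.\<close>

lemma vanishing_fc_closed:
  assumes h: "vanishing_fc h" and C: "closed C"
  shows "(\<integral>x. indicator C (cis x) * h x \<partial>circ) = 0"
\<comment> \<open>\<open>infdist\<close> to the empty set is 0 by convention, so the approximating
  functions would be constantly 1 there.\<close>
proof (cases "C = {}")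
  case False
  have ih: "integrable circ h" using h by (simp add: vanishing_fc_def)
  then have [measurable]: "h \<in> borel_measurable circ" by auto
  have [measurable]: "C \<in> sets borel" using C by auto
  have [measurable]: "cis \<in> borel_measurable borel"
    by (intro borel_measurable_continuous_onI continuous_intros)
  define \<phi> where "\<phi> n z = max 0 (1 - real n * infdist z C)" for n z
  have c: "continuous_on UNIV (\<phi> n)" for n
    unfolding \<phi>_def by (intro continuous_intros)
  have [measurable]: "\<phi> n \<in> borel_measurable borel" for n
    using c by (rule borel_measurable_continuous_onI)
  have lim: "(\<lambda>n. \<phi> n z) \<longlonglongrightarrow> indicator C z" for z
  proof (cases "z \<in> C")
    case True then show ?thesis by (simp add: \<phi>_def)
  next
    case z: False
    then have pos: "infdist z C > 0"
      using infdist_pos_not_in_closed[OF C False] by auto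
    obtain N where "real N > 1 / infdist z C" using reals_Archimedean2 by blast
    then have N: "real N * infdist z C > 1" using pos by (simp add: field_simps)
    have "\<phi> n z = 0" if "n \<ge> N" for n
    proof -
      have "real n * infdist z C \<ge> real N * infdist z C"
        using that pos by (intro mult_right_mono) auto
      then show ?thesis using N by (simp add: \<phi>_def)
    qed
    then have "eventually (\<lambda>n. \<phi> n z = 0) sequentially"
      by (auto simp: eventually_sequentially)
    then show ?thesis using z by (simp add: tendsto_eventually)
  qed
  have "(\<lambda>n. \<integral>x. of_real (\<phi> n (cis x)) * h x \<partial>circ) \<longlonglongrightarrow>
        (\<integral>x. of_real (indicator C (cis x)) * h x \<partial>circ)"
  proof (rule integral_dominated_convergence[where w = "\<lambda>x. cmod (h x)"])
    show "AE x in circ. (\<lambda>n. of_real (\<phi> n (cis x)) * h x) \<longlonglongrightarrow> of_real (indicator C (cis x)) * h x"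
      by (intro AE_I2 tendsto_intros lim)
    show "AE x in circ. cmod (of_real (\<phi> n (cis x)) * h x) \<le> cmod (h x)" for n
    proof (intro AE_I2)
      fix x
      have "\<bar>\<phi> n (cis x)\<bar> \<le> 1" by (auto simp: \<phi>_def infdist_nonneg)
      then show "cmod (of_real (\<phi> n (cis x)) * h x) \<le> cmod (h x)"
        by (simp add: norm_mult mult_left_le_one_le)
    qed
  qed (use ih in auto)
  then have "(\<integral>x. of_real (indicator C (cis x)) * h x \<partial>circ) = 0"
    by (simp add: vanishing_fc_continuous[OF h c] LIMSEQ_const_iff)
  then show ?thesis by (simp add: of_real_indicator)
qed simp

text \<open>A density whose integral over every Borel set is zero vanishes almost everywhere. Borel
  sets are generated from closed intervals by complements and disjoint unions, and an interval
  corresponds to a closed arc.\<close>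

theorem vanishing_fc_AE_0:
  assumes h: "vanishing_fc h"
  shows "AE x in circ. h x = 0"
proof (rule circ.density_zero)
  show ih: "integrable circ h" using h by (simp add: vanishing_fc_def)
  have set_int: "(LINT x:A|circ. h x) = (\<integral>x. indicator A x * h x \<partial>circ)" for A
    unfolding set_lebesgue_integral_def
    by (intro Bochner_Integration.integral_cong) (auto split: split_indicator)
  fix A assume "A \<in> sets circ"
  then have "A \<in> sets borel" by simp
  then have "(\<integral>x. indicator A x * h x \<partial>circ) = 0"
  proof (induction rule: borel_set_induct)
    case (interval a b)
    \<comment> \<open>Clipping to \<open>{0..2*pi}\<close> does not change the part of the interval
      that \<open>circ\<close> sees, and makes its image a compact arc.\<close>
    define C where "C = cis ` {max a 0..min b (2*pi)}"
    have "compact C" unfolding C_def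
      by (intro compact_continuous_image continuous_intros) auto
    then have "closed C" by (rule compact_imp_closed)
    have "(\<integral>x. indicator {a..b} x * h x \<partial>circ) = (\<integral>x. indicator C (cis x) * h x \<partial>circ)"
    proof (rule integral_cong_AE)
      show "AE x in circ. indicator {a..b} x * h x = indicator C (cis x) * h x"
        using AE_circ_interior
      proof eventually_elim
        case (elim x)
        \<comment> \<open>Angles with the same image under \<open>cis\<close> differ by a multiple
          of a full turn. Since \<open>x\<close> lies strictly between 0 and \<open>2*pi\<close> and
          \<open>y\<close> in the closed interval, the multiple is zero; for \<open>x = 0\<close> it
          could be a full turn, which is why the null set of endpoints was removed.\<close>
        have "cis x \<in> C \<longleftrightarrow> x \<in> {a..b}"
        proof
          assume "cis x \<in> C"
          then obtain y where y: "max a 0 \<le> y" "y \<le> min b (2*pi)" "cis x = cis y" by (auto simp: C_def)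
          then have "sin x = sin y \<and> cos x = cos y" by (simp add: complex_eq_iff)
          then obtain n :: int where n: "x = y + 2 * pi * n" by (auto simp: sin_cos_eq_iff)
          have "n < 1"
          proof (rule ccontr)
            assume "\<not> n < 1"
            then have "2 * pi * 1 \<le> 2 * pi * real_of_int n" by (intro mult_left_mono) auto
            then show False using n y(1,2) elim by linarith
          qed
          moreover have "n > -1"
          proof (rule ccontr)
            assume "\<not> n > -1"
            then have "2 * pi * real_of_int n \<le> 2 * pi * (-1)" by (intro mult_left_mono) auto
            then show False using n y(1,2) elim by linarith
          qed
          ultimately have "n = 0" by simp
          then show "x \<in> {a..b}" using n y by auto
        qed (use elim in \<open>auto simp: C_def\<close>)
        then show ?case by (simp add: indicator_def)
      qed
      have [measurable]: "h \<in> borel_measurable circ" using ih by auto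
      have [measurable]: "C \<in> sets borel" using \<open>closed C\<close> by auto
      have [measurable]: "cis \<in> borel_measurable borel"
        by (intro borel_measurable_continuous_onI continuous_intros)
      show "(\<lambda>x. indicator {a..b} x * h x) \<in> borel_measurable circ" by measurable
      show "(\<lambda>x. indicator C (cis x) * h x) \<in> borel_measurable circ" by measurable
    qed
    then show ?case using vanishing_fc_closed[OF h \<open>closed C\<close>] by simp
  next
    case (compl A)
    have [simp]: "integrable circ (\<lambda>x. indicator A x * h x)"
      by (rule integrable_bounded_mult[OF ih, where C = 1]) (use compl in \<open>auto simp: indicator_def\<close>)
    have "(\<integral>x. h x \<partial>circ) = 0" using h ech_0 by (auto simp: vanishing_fc_def dest: spec[of _ 0])
    moreover have "(\<lambda>x. indicator (-A) x * h x) = (\<lambda>x. h x - indicator A x * h x)"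
      by (auto simp: fun_eq_iff indicator_def)
    ultimately show ?case using compl ih by simp
  next
    case (union F)
    have "set_integrable circ (\<Union>i. F i) h"
      unfolding set_integrable_def using union(2) by (intro integrable_mult_indicator ih) auto
    then have "(LINT x:(\<Union>i. F i)|circ. h x) = (\<Sum>i. LINT x:F i|circ. h x)"
      using union(1,2) by (intro lebesgue_integral_countable_add) (auto simp: disjoint_family_on_def)
    also have "\<dots> = 0"
      using union(3) by (simp add: set_int)
    finally show ?case by (simp add: set_int)
  qed simp
  then show "(LINT x:A|circ. h x) = 0" by (simp add: set_int)
qed

section \<open>Limits along integer windows, and a Fatou bound\<close>

text \<open>The centre \<open>a\<close> is kept general because shifting or reflecting lags turns
  windows around 0 into windows around another integer.\<close>

lemma filterlim_int_intervals:
  "filterlim (\<lambda>n. {a - int n..a + int n}) (finite_subsets_at_top UNIV) sequentially"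
  unfolding filterlim_finite_subsets_at_top
proof safe
  fix X :: "int set" assume "finite X"
  then obtain N where N: "\<And>x. x \<in> X \<Longrightarrow> \<bar>x - a\<bar> \<le> N"
    using bdd_above_finite[of "(\<lambda>x. \<bar>x - a\<bar>) ` X"] by (auto simp: bdd_above_def)
  have "x \<in> {a - int n..a + int n}" if "n \<ge> nat N" "x \<in> X" for n x
    using N[OF that(2)] that(1) by auto
  then have "\<forall>n\<ge>nat N. X \<subseteq> {a - int n..a + int n}" by blast
  then show "eventually (\<lambda>n. finite {a - int n..a + int n} \<and> X \<subseteq> {a - int n..a + int n} \<and> {a - int n..a + int n} \<subseteq> UNIV) sequentially"
    unfolding eventually_sequentially by blast
qed

lemma summable_on_symm_tendsto:
  fixes f :: "int \<Rightarrow> 'a :: {comm_monoid_add, t2_space}"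
  assumes "f summable_on UNIV"
  shows "(\<lambda>n. \<Sum>k\<in>{- int n..int n}. f k) \<longlonglongrightarrow> infsum f UNIV"
  using filterlim_compose[OF infsum_tendsto[OF assms] filterlim_int_intervals[of 0]] by simp

lemma sum_symm_uminus:
  fixes f :: "int \<Rightarrow> 'a :: comm_monoid_add"
  shows "(\<Sum>k\<in>{- int n..int n}. f (- k)) = (\<Sum>k\<in>{- int n..int n}. f k)"
  by (rule sum.reindex_bij_witness[where i = uminus and j = uminus]) auto

text \<open>Fatou's lemma, packaged so that the pointwise limit receives integrability and the bound
  together, although the bound is available only from some index on. It identifies limits both in L2
  of the circle and in the third mean on the probability space.\<close>

lemma Fatou_integral_le:
  fixes f :: "nat \<Rightarrow> 'a \<Rightarrow> real" and b :: real
  assumes int: "\<And>n. integrable M (f n)" and nn: "\<And>n x. 0 \<le> f n x"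
    and [measurable]: "g \<in> borel_measurable M"
    and lim: "AE x in M. (\<lambda>n. f n x) \<longlonglongrightarrow> g x"
    and bd: "eventually (\<lambda>n. integral\<^sup>L M (f n) \<le> b) sequentially"
  shows "integrable M g" "integral\<^sup>L M g \<le> b"
proof -
  have g0: "AE x in M. 0 \<le> g x"
    using lim by eventually_elim (rule LIMSEQ_le_const, auto intro: nn)
  have "(\<integral>\<^sup>+x. ennreal (g x) \<partial>M) = (\<integral>\<^sup>+x. liminf (\<lambda>n. ennreal (f n x)) \<partial>M)"
  proof (rule nn_integral_cong_AE)
    show "AE x in M. ennreal (g x) = liminf (\<lambda>n. ennreal (f n x))"
      using lim by eventually_elim (metis tendsto_ennrealI lim_imp_Liminf trivial_limit_sequentially)
  qed
  also have "\<dots> \<le> liminf (\<lambda>n. \<integral>\<^sup>+x. ennreal (f n x) \<partial>M)"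
    by (rule nn_integral_liminf) (use int in auto)
  also have "(\<lambda>n. \<integral>\<^sup>+x. ennreal (f n x) \<partial>M) = (\<lambda>n. ennreal (integral\<^sup>L M (f n)))"
    by (intro ext nn_integral_eq_integral int AE_I2 nn)
  also have "liminf \<dots> \<le> ennreal b"
    using bd by (intro Liminf_le) (auto elim!: eventually_mono intro: ennreal_leI)
  finally have le: "(\<integral>\<^sup>+x. ennreal (g x) \<partial>M) \<le> ennreal b" .
  show int_g: "integrable M g"
    by (rule integrableI_nonneg) (use g0 le in \<open>auto simp: less_top[symmetric] top_unique\<close>)
  have "b \<ge> 0"
  proof -
    from bd obtain n where "integral\<^sup>L M (f n) \<le> b" by (auto simp: eventually_sequentially)
    moreover have "integral\<^sup>L M (f n) \<ge> 0" by (simp add: nn)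
    ultimately show ?thesis by simp
  qed
  then show "integral\<^sup>L M g \<le> b"
    using le g0 by (simp add: nn_integral_eq_integral[OF int_g g0])
qed

section \<open>Square-integrable Fourier series\<close>

definition sq_int :: "(real \<Rightarrow> complex) \<Rightarrow> bool" where
  "sq_int g \<longleftrightarrow> g \<in> borel_measurable circ \<and> integrable circ (\<lambda>x. (cmod (g x))\<^sup>2)"

lemma sq_int_measurable [measurable_dest]: "sq_int g \<Longrightarrow> g \<in> borel_measurable circ"
  by (simp add: sq_int_def)

lemma sq_int_norm_mult:
  assumes g: "sq_int g" and h: "sq_int h"
  shows "integrable circ (\<lambda>x. cmod (g x) * cmod (h x))"
proof (rule Bochner_Integration.integrable_bound)
  show "integrable circ (\<lambda>x. (cmod (g x))\<^sup>2 + (cmod (h x))\<^sup>2)"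
    using g h by (simp add: sq_int_def)
  show "(\<lambda>x. cmod (g x) * cmod (h x)) \<in> borel_measurable circ"
    using g h by measurable
  have "a * b \<le> a\<^sup>2 + b\<^sup>2" if "a \<ge> 0" "b \<ge> 0" for a b :: real
    using sum_squares_bound[of a b] mult_nonneg_nonneg[OF that] by linarith
  then show "AE x in circ. norm (cmod (g x) * cmod (h x)) \<le> norm ((cmod (g x))\<^sup>2 + (cmod (h x))\<^sup>2)"
    by auto
qed

lemma sq_int_mult:
  assumes "sq_int g" "sq_int h"
  shows "integrable circ (\<lambda>x. g x * h x)"
  using sq_int_norm_mult[OF assms] assms
  by (auto simp: norm_mult sq_int_def intro: integrable_norm_cancel)

lemma sq_int_bounded:
  assumes "g \<in> borel_measurable circ" "\<And>x. cmod (g x) \<le> C"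
  shows "sq_int g"
proof -
  have "integrable circ (\<lambda>x. (cmod (g x))\<^sup>2)"
    using assms(1)
    by (intro circ.integrable_const_bound[where B = "C\<^sup>2"]) (auto intro!: power_mono assms(2))
  then show ?thesis using assms by (simp add: sq_int_def)
qed

lemma sq_int_bounded_mult:
  assumes "g \<in> borel_measurable circ" "\<And>x. cmod (g x) \<le> C" "sq_int h"
  shows "sq_int (\<lambda>x. g x * h x)"
proof -
  have "integrable circ (\<lambda>x. (cmod (g x * h x))\<^sup>2)"
  proof (rule Bochner_Integration.integrable_bound)
    show "integrable circ (\<lambda>x. C\<^sup>2 * (cmod (h x))\<^sup>2)" using assms(3) by (simp add: sq_int_def)
    show "AE x in circ. norm ((cmod (g x * h x))\<^sup>2) \<le> norm (C\<^sup>2 * (cmod (h x))\<^sup>2)"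
      by (auto simp: norm_mult power_mult_distrib intro!: mult_right_mono power_mono assms(2))
  qed (use assms(1,3) in measurable)
  moreover have "(\<lambda>x. g x * h x) \<in> borel_measurable circ" using assms(1,3) by measurable
  ultimately show ?thesis by (simp add: sq_int_def)
qed

lemma sq_int_ech [simp]: "sq_int (ech k)"
  by (rule sq_int_bounded[where C = 1]) auto

lemma sq_int_ech_mult: "sq_int h \<Longrightarrow> sq_int (\<lambda>x. ech k x * h x)"
  by (rule sq_int_bounded_mult[where C = 1]) auto

lemma borel_measurable_cnj [measurable]: "cnj \<in> borel_measurable borel"
  by (intro borel_measurable_continuous_onI continuous_intros)

lemma sq_int_cnj: "sq_int h \<Longrightarrow> sq_int (\<lambda>x. cnj (h x))"
  by (auto simp: sq_int_def intro: measurable_compose[OF _ borel_measurable_cnj])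

lemma sq_int_cmult: "sq_int h \<Longrightarrow> sq_int (\<lambda>x. c * h x)"
  by (rule sq_int_bounded_mult[where C = "cmod c"]) auto

lemma sq_int_add:
  assumes g: "sq_int g" and h: "sq_int h"
  shows "sq_int (\<lambda>x. g x + h x)"
proof -
  have "integrable circ (\<lambda>x. (cmod (g x + h x))\<^sup>2)"
  proof (rule Bochner_Integration.integrable_bound)
    show "integrable circ (\<lambda>x. (cmod (g x))\<^sup>2 + 2 * (cmod (g x) * cmod (h x)) + (cmod (h x))\<^sup>2)"
      using g h sq_int_norm_mult[OF g h] by (simp add: sq_int_def)
    have "(cmod (g x + h x))\<^sup>2 \<le> (cmod (g x) + cmod (h x))\<^sup>2" for x
      by (intro power_mono norm_triangle_ineq) auto
    then show "AE x in circ. norm ((cmod (g x + h x))\<^sup>2) \<le>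
        norm ((cmod (g x))\<^sup>2 + 2 * (cmod (g x) * cmod (h x)) + (cmod (h x))\<^sup>2)"
      by (auto simp: power2_sum algebra_simps)
  qed (use g h in measurable)
  moreover have "(\<lambda>x. g x + h x) \<in> borel_measurable circ" using g h by measurable
  ultimately show ?thesis by (simp add: sq_int_def)
qed

lemma sq_int_diff:
  assumes "sq_int g" "sq_int h"
  shows "sq_int (\<lambda>x. g x - h x)"
  using sq_int_add[OF assms(1) sq_int_cmult[OF assms(2), of "-1"]] by simp

lemma sq_int_integrable: "sq_int g \<Longrightarrow> integrable circ g"
  using sq_int_mult[of g "ech 0"] by simp

lemma cauchy_schwarz_circ:
  assumes g: "sq_int g" and h: "sq_int h"
  shows "(\<integral>x. cmod (g x) * cmod (h x) \<partial>circ) \<le>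
    sqrt ((\<integral>x. (cmod (g x))\<^sup>2 \<partial>circ) * (\<integral>x. (cmod (h x))\<^sup>2 \<partial>circ))"
proof -
  have [measurable]: "g \<in> borel_measurable circ" "h \<in> borel_measurable circ"
    using g h by auto
  have "ennreal ((\<integral>x. cmod (g x) * cmod (h x) \<partial>circ)\<^sup>2) = (\<integral>\<^sup>+x. ennreal (cmod (g x)) * ennreal (cmod (h x)) \<partial>circ)\<^sup>2"
    using sq_int_norm_mult[OF g h]
    by (simp add: nn_integral_eq_integral ennreal_power flip: ennreal_mult)
  also have "\<dots> \<le> (\<integral>\<^sup>+x. (ennreal (cmod (g x)))\<^sup>2 \<partial>circ) * (\<integral>\<^sup>+x. (ennreal (cmod (h x)))\<^sup>2 \<partial>circ)"
    by (rule Cauchy_Schwarz_nn_integral) measurable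
  also have "\<dots> = ennreal ((\<integral>x. (cmod (g x))\<^sup>2 \<partial>circ) * (\<integral>x. (cmod (h x))\<^sup>2 \<partial>circ))"
    using g h by (simp add: sq_int_def ennreal_power nn_integral_eq_integral ennreal_mult)
  finally have "(\<integral>x. cmod (g x) * cmod (h x) \<partial>circ)\<^sup>2 \<le>
      (\<integral>x. (cmod (g x))\<^sup>2 \<partial>circ) * (\<integral>x. (cmod (h x))\<^sup>2 \<partial>circ)"
    by (subst (asm) ennreal_le_iff) auto
  then show ?thesis by (rule real_le_rsqrt)
qed

section \<open>Trigonometric polynomials and Fourier series in L2\<close>

definition trig :: "(int \<Rightarrow> complex) \<Rightarrow> int set \<Rightarrow> real \<Rightarrow> complex" where
  "trig a K x = (\<Sum>k\<in>K. a k * ech k x)"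

lemma sq_int_trig: "sq_int (trig a K)"
proof (rule sq_int_bounded)
  show "cmod (trig a K x) \<le> (\<Sum>k\<in>K. cmod (a k))" for x
    unfolding trig_def by (rule sum_norm_le) (simp add: norm_mult)
  have "(\<lambda>x. \<Sum>k\<in>K. a k * ech k x) \<in> borel_measurable circ" by measurable
  then show "trig a K \<in> borel_measurable circ" by (simp add: trig_def[abs_def])
qed

lemma integral_trig_mult:
  assumes "sq_int V"
  shows "(\<integral>x. trig a K x * V x \<partial>circ) = (\<Sum>k\<in>K. a k * (\<integral>x. ech k x * V x \<partial>circ))"
proof -
  have "(\<integral>x. trig a K x * V x \<partial>circ) = (\<integral>x. (\<Sum>k\<in>K. a k * (ech k x * V x)) \<partial>circ)"
    by (simp add: trig_def sum_distrib_right mult.assoc)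
  also have "\<dots> = (\<Sum>k\<in>K. a k * (\<integral>x. ech k x * V x \<partial>circ))"
    by (subst Bochner_Integration.integral_sum) (auto intro!: sq_int_mult[OF sq_int_ech assms] integrable_mult_right)
  finally show ?thesis .
qed

lemma integral_norm_trig:
  assumes "finite K"
  shows "(\<integral>x. (cmod (trig a K x))\<^sup>2 \<partial>circ) = (\<Sum>k\<in>K. (cmod (a k))\<^sup>2)"
proof -
  have "(\<integral>x. trig a K x * cnj (trig a K x) \<partial>circ) =
      (\<Sum>k\<in>K. a k * (\<integral>x. ech k x * cnj (trig a K x) \<partial>circ))"
    by (intro integral_trig_mult sq_int_cnj sq_int_trig)
  also have "\<dots> = (\<Sum>k\<in>K. a k * cnj (a k))"
  proof (rule sum.cong)
    fix k assume "k \<in> K"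
    have "(\<integral>x. ech k x * cnj (trig a K x) \<partial>circ) = (\<integral>x. cnj (trig a K x * ech (-k) x) \<partial>circ)"
      by (simp add: ech_uminus mult.commute)
    also have "\<dots> = cnj (\<integral>x. trig a K x * ech (-k) x \<partial>circ)"
      by (rule Bochner_Integration.integral_cnj)
    also have "(\<integral>x. trig a K x * ech (-k) x \<partial>circ) = (\<Sum>j\<in>K. a j * (\<integral>x. ech (j - k) x \<partial>circ))"
      by (subst integral_trig_mult) (auto simp flip: ech_add)
    also have "\<dots> = (\<Sum>j\<in>K. if k = j then a j else 0)"
      by (rule sum.cong) (auto simp: integral_ech)
    also have "\<dots> = a k" using assms \<open>k \<in> K\<close> by simp
    finally show "a k * (\<integral>x. ech k x * cnj (trig a K x) \<partial>circ) = a k * cnj (a k)" by simp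
  qed simp
  finally have "complex_of_real (\<integral>x. (cmod (trig a K x))\<^sup>2 \<partial>circ) = complex_of_real (\<Sum>k\<in>K. (cmod (a k))\<^sup>2)"
    by (simp only: of_real_sum complex_norm_square flip: integral_complex_of_real)
  then show ?thesis by (simp only: of_real_eq_iff)
qed

text \<open>A relation rather than a function of \<open>a\<close>: the sum is determined only up to
  null sets. Convergence is in the L2 norm, along symmetric windows.\<close>

definition fourier_series :: "(int \<Rightarrow> complex) \<Rightarrow> (real \<Rightarrow> complex) \<Rightarrow> bool" where
  "fourier_series a A \<longleftrightarrow> sq_int A \<and>
     (\<lambda>n. \<integral>x. (cmod (A x - trig a {- int n..int n} x))\<^sup>2 \<partial>circ) \<longlonglongrightarrow> 0"

text \<open>By Cauchy-Schwarz, integration against a square-integrable \<open>V\<close> is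
  continuous in the L2 norm, hence passes through the series. The pairing is bilinear, without a
  conjugate on \<open>V\<close>.\<close>

lemma fourier_series_integral_mult:
  assumes A: "fourier_series a A" and V: "sq_int V"
  shows "(\<lambda>n. \<Sum>k\<in>{- int n..int n}. a k * (\<integral>x. ech k x * V x \<partial>circ)) \<longlonglongrightarrow> (\<integral>x. A x * V x \<partial>circ)"
proof -
  let ?S = "\<lambda>n. trig a {- int n..int n}"
  have sA: "sq_int A" using A by (simp add: fourier_series_def)
  have "(\<lambda>n. (\<integral>x. ?S n x * V x \<partial>circ) - (\<integral>x. A x * V x \<partial>circ)) \<longlonglongrightarrow> 0"
  proof (rule Lim_null_comparison)
    show "(\<lambda>n. sqrt ((\<integral>x. (cmod (A x - ?S n x))\<^sup>2 \<partial>circ) * (\<integral>x. (cmod (V x))\<^sup>2 \<partial>circ))) \<longlonglongrightarrow> 0"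
    proof -
      have "(\<lambda>n. sqrt ((\<integral>x. (cmod (A x - ?S n x))\<^sup>2 \<partial>circ) * (\<integral>x. (cmod (V x))\<^sup>2 \<partial>circ))) \<longlonglongrightarrow>
          sqrt (0 * (\<integral>x. (cmod (V x))\<^sup>2 \<partial>circ))"
        using A by (intro tendsto_intros) (simp add: fourier_series_def)
      then show ?thesis by simp
    qed
    show "eventually (\<lambda>n. norm ((\<integral>x. ?S n x * V x \<partial>circ) - (\<integral>x. A x * V x \<partial>circ)) \<le>
       sqrt ((\<integral>x. (cmod (A x - ?S n x))\<^sup>2 \<partial>circ) * (\<integral>x. (cmod (V x))\<^sup>2 \<partial>circ))) sequentially"
    proof (rule always_eventually, rule allI)
      fix n
      have d: "sq_int (\<lambda>x. A x - ?S n x)" by (intro sq_int_diff sA sq_int_trig)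
      have "(\<integral>x. A x * V x \<partial>circ) - (\<integral>x. ?S n x * V x \<partial>circ) = (\<integral>x. (A x - ?S n x) * V x \<partial>circ)"
        by (simp add: left_diff_distrib sq_int_mult sA V sq_int_trig)
      then have "norm ((\<integral>x. ?S n x * V x \<partial>circ) - (\<integral>x. A x * V x \<partial>circ)) =
          cmod (\<integral>x. (A x - ?S n x) * V x \<partial>circ)"
        by (metis norm_minus_commute)
      also have "\<dots> \<le> (\<integral>x. cmod ((A x - ?S n x) * V x) \<partial>circ)" by (rule integral_norm_bound)
      also have "\<dots> = (\<integral>x. cmod (A x - ?S n x) * cmod (V x) \<partial>circ)" by (simp add: norm_mult)
      also note cauchy_schwarz_circ[OF d V]
      finally show "norm ((\<integral>x. ?S n x * V x \<partial>circ) - (\<integral>x. A x * V x \<partial>circ)) \<le>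
         sqrt ((\<integral>x. (cmod (A x - ?S n x))\<^sup>2 \<partial>circ) * (\<integral>x. (cmod (V x))\<^sup>2 \<partial>circ))" .
    qed
  qed
  then have "(\<lambda>n. (\<integral>x. ?S n x * V x \<partial>circ)) \<longlonglongrightarrow> (\<integral>x. A x * V x \<partial>circ)"
    by (simp add: LIM_zero_iff)
  then show ?thesis unfolding integral_trig_mult[OF V] .
qed

lemma fourier_series_coeff:
  assumes A: "fourier_series a A"
  shows "(\<integral>x. A x * ech (- k) x \<partial>circ) = a k"
proof -
  have "(\<Sum>j\<in>{- int n..int n}. a j * (\<integral>x. ech j x * ech (- k) x \<partial>circ)) = a k" if "n \<ge> nat \<bar>k\<bar>" for n
  proof -
    have "(\<Sum>j\<in>{- int n..int n}. a j * (\<integral>x. ech j x * ech (- k) x \<partial>circ)) =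
        (\<Sum>j\<in>{- int n..int n}. if k = j then a j else 0)"
      by (rule sum.cong) (auto simp: integral_ech simp flip: ech_add)
    also have "\<dots> = a k" using that by auto
    finally show ?thesis .
  qed
  then have "eventually (\<lambda>n. (\<Sum>j\<in>{- int n..int n}. a j * (\<integral>x. ech j x * ech (- k) x \<partial>circ)) = a k) sequentially"
    unfolding eventually_sequentially by blast
  then have "(\<lambda>n. \<Sum>j\<in>{- int n..int n}. a j * (\<integral>x. ech j x * ech (- k) x \<partial>circ)) \<longlonglongrightarrow> a k"
    by (rule tendsto_eventually)
  then show ?thesis
    using LIMSEQ_unique[OF fourier_series_integral_mult[OF A sq_int_ech]] by simp
qed

text \<open>Multiplication by \<open>ech t\<close> shifts coefficients, so this is Parseval's
  identity for a shifted sequence: the Fourier coefficients of \<open>A x * cnj (B x)\<close> are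
  the cross-correlations of \<open>a\<close> and \<open>b\<close>. Triple correlations enter with
  \<open>a\<close> itself a product of two coefficients.\<close>

lemma fourier_series_parseval:
  assumes A: "fourier_series a A" and B: "fourier_series b B"
  shows "(\<lambda>n. \<Sum>k\<in>{- int n..int n}. a k * cnj (b (k + t))) \<longlonglongrightarrow> (\<integral>x. ech t x * (A x * cnj (B x)) \<partial>circ)"
proof -
  have sB: "sq_int B" using B by (simp add: fourier_series_def)
  have "(\<integral>x. ech k x * (ech t x * cnj (B x)) \<partial>circ) = cnj (b (k + t))" for k
  proof -
    have "(\<integral>x. ech k x * (ech t x * cnj (B x)) \<partial>circ) = (\<integral>x. cnj (B x * ech (- (k + t)) x) \<partial>circ)"
      by (simp add: ech_uminus ech_add mult_ac del: minus_add_distrib)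
    also have "\<dots> = cnj (b (k + t))"
      by (simp only: Bochner_Integration.integral_cnj fourier_series_coeff[OF B])
    finally show ?thesis .
  qed
  then show ?thesis
    using fourier_series_integral_mult[OF A sq_int_ech_mult[OF sq_int_cnj[OF sB]], of t]
    by (simp add: mult_ac)
qed

text \<open>The existence half of Riesz-Fischer. Orthonormality makes the L2 distance of partial
  sums a tail of the series of squares; the limit is built from an almost everywhere convergent
  subsequence, and Fatou carries the tail bound over to it.\<close>

lemma fourier_series_exists:
  assumes sm: "(\<lambda>k. (cmod (a k))\<^sup>2) summable_on UNIV"
  shows "\<exists>A. fourier_series a A"
proof -
  let ?q = "\<lambda>k. (cmod (a k))\<^sup>2" and ?S = "\<lambda>n. trig a {- int n..int n}"
  define \<tau> where "\<tau> n = infsum ?q UNIV - (\<Sum>k\<in>{- int n..int n}. ?q k)" for n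
  have \<tau>0: "\<tau> \<longlonglongrightarrow> 0"
    unfolding \<tau>_def using tendsto_diff[OF tendsto_const summable_on_symm_tendsto[OF sm], of "infsum ?q UNIV"] by simp
  have step: "(\<integral>x. (cmod (?S m x - ?S n x))\<^sup>2 \<partial>circ) \<le> \<tau> n" if "n \<le> m" for m n
  proof -
    have sub: "{- int n..int n} \<subseteq> {- int m..int m}" using that by auto
    have "?S m x - ?S n x = trig a ({- int m..int m} - {- int n..int n}) x" for x
      unfolding trig_def using sub by (simp add: sum_diff)
    then have "(\<integral>x. (cmod (?S m x - ?S n x))\<^sup>2 \<partial>circ) = (\<Sum>k\<in>{- int m..int m} - {- int n..int n}. ?q k)"
      by (simp add: integral_norm_trig)
    also have "\<dots> = (\<Sum>k\<in>{- int m..int m}. ?q k) - (\<Sum>k\<in>{- int n..int n}. ?q k)"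
      using sub by (simp add: sum_diff)
    also have "(\<Sum>k\<in>{- int m..int m}. ?q k) \<le> infsum ?q UNIV"
      by (rule finite_sum_le_infsum[OF sm]) auto
    finally show ?thesis by (simp add: \<tau>_def)
  qed
  have L1: "(\<integral>x. cmod (?S i x - ?S j x) \<partial>circ) \<le> sqrt (\<tau> n)" if "n \<le> j" "j \<le> i" for i j n
  proof -
    have "\<tau> j \<le> \<tau> n"
      unfolding \<tau>_def using that by (intro diff_left_mono sum_mono2) auto
    have "(\<integral>x. cmod (?S i x - ?S j x) \<partial>circ) \<le> sqrt (\<integral>x. (cmod (?S i x - ?S j x))\<^sup>2 \<partial>circ)"
      using cauchy_schwarz_circ[OF sq_int_diff[OF sq_int_trig sq_int_trig] sq_int_ech[of 0]]
        circ.prob_space by simp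
    also have "\<dots> \<le> sqrt (\<tau> n)" using step[OF that(2)] \<open>\<tau> j \<le> \<tau> n\<close> by simp
    finally show ?thesis .
  qed
  \<comment> \<open>The subsequence theorem works in L1. On a probability space the L1 norm is at
    most the L2 norm, so the bound by \<open>sqrt (\<tau> n)\<close> is what it needs.\<close>
  obtain r where r: "strict_mono r" "AE x in circ. Cauchy (\<lambda>i. ?S (r i) x)"
  proof (rule cauchy_L1_AE_cauchy_subseq[of circ ?S])
    show "integrable circ (?S n)" for n by (intro sq_int_integrable sq_int_trig)
    fix e :: real assume "e > 0"
    then have "eventually (\<lambda>n. sqrt (\<tau> n) < e) sequentially"
      using order_tendstoD(2)[OF tendsto_real_sqrt[OF \<tau>0]] by simp
    then obtain n where n: "sqrt (\<tau> n) < e" by (auto simp: eventually_sequentially)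
    have "(\<integral>x. cmod (?S i x - ?S j x) \<partial>circ) < e" if "i \<ge> n" "j \<ge> n" for i j
      using L1[of n j i] L1[of n i j] that n
      by (cases "j \<le> i") (auto simp: norm_minus_commute)
    then show "\<exists>N. \<forall>i\<ge>N. \<forall>j\<ge>N. (\<integral>x. cmod (?S i x - ?S j x) \<partial>circ) < e" by blast
  qed blast
  \<comment> \<open>Where the subsequence diverges, \<open>lim\<close> has an unspecified value;
    this concerns a null set only.\<close>
  define A where "A x = lim (\<lambda>i. ?S (r i) x)" for x
  have lim: "AE x in circ. (\<lambda>i. ?S (r i) x) \<longlonglongrightarrow> A x"
    using r(2) by eventually_elim (simp add: A_def Cauchy_convergent_iff convergent_LIMSEQ_iff)
  have mS [measurable]: "?S n \<in> borel_measurable circ" for n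
    using sq_int_trig by (rule sq_int_measurable)
  have mA [measurable]: "A \<in> borel_measurable circ"
    unfolding A_def by (rule borel_measurable_lim_metric) measurable
  have A: "integrable circ (\<lambda>x. (cmod (A x - ?S n x))\<^sup>2)" "(\<integral>x. (cmod (A x - ?S n x))\<^sup>2 \<partial>circ) \<le> \<tau> n" for n
  proof -
    have *: "integrable circ (\<lambda>x. (cmod (?S (r i) x - ?S n x))\<^sup>2)" for i
      using sq_int_diff[OF sq_int_trig sq_int_trig] by (simp add: sq_int_def)
    have l: "AE x in circ. (\<lambda>i. (cmod (?S (r i) x - ?S n x))\<^sup>2) \<longlonglongrightarrow> (cmod (A x - ?S n x))\<^sup>2"
      using lim by eventually_elim (intro tendsto_intros)
    have b: "eventually (\<lambda>i. (\<integral>x. (cmod (?S (r i) x - ?S n x))\<^sup>2 \<partial>circ) \<le> \<tau> n) sequentially"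
      using strict_mono_imp_increasing[OF r(1)]
      by (auto simp: eventually_sequentially intro!: exI[of _ n] step elim: order_trans)
    note F = Fatou_integral_le[OF * _ _ l b]
    show "integrable circ (\<lambda>x. (cmod (A x - ?S n x))\<^sup>2)" "(\<integral>x. (cmod (A x - ?S n x))\<^sup>2 \<partial>circ) \<le> \<tau> n"
      by (rule F; simp)+
  qed
  \<comment> \<open>Square integrability is known for differences from partial sums; adding back the
    partial sum with \<open>n = 0\<close> yields it for \<open>A\<close>.\<close>
  have "(\<lambda>x. A x - ?S 0 x) \<in> borel_measurable circ" by measurable
  then have "sq_int (\<lambda>x. A x - ?S 0 x)" using A(1)[of 0] by (simp add: sq_int_def)
  from sq_int_add[OF this sq_int_trig[of a "{- int 0..int 0}"]] have "sq_int A" by simp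
  moreover have "(\<lambda>n. \<integral>x. (cmod (A x - ?S n x))\<^sup>2 \<partial>circ) \<longlonglongrightarrow> 0"
    by (rule tendsto_sandwich[OF _ _ tendsto_const \<tau>0]) (auto intro!: always_eventually A)
  ultimately show ?thesis unfolding fourier_series_def by blast
qed

section \<open>Triple correlations determine a sequence up to reflection\<close>

text \<open>Provides the transforms of the two auxiliary sequences of the reflection argument:
  \<open>c\<close> times a shift of \<open>c\<close>, and \<open>c\<close> times a reflected
  sequence of coefficients of \<open>u\<close>.\<close>

lemma fourier_series_exists_bounded_mult:
  fixes c :: "int \<Rightarrow> real"
  assumes sm: "(\<lambda>k. (c k)\<^sup>2) summable_on UNIV" and b: "\<And>k. (cmod (b k))\<^sup>2 \<le> Q"
  shows "\<exists>A. fourier_series (\<lambda>k. of_real (c k) * b k) A"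
proof (rule fourier_series_exists, rule summable_on_comparison_test)
  show "(\<lambda>k. Q * (c k)\<^sup>2) summable_on UNIV" by (intro summable_on_cmult_right sm)
  show "(cmod (complex_of_real (c k) * b k))\<^sup>2 \<le> Q * (c k)\<^sup>2" for k
    using b[of k] by (simp add: norm_mult power_mult_distrib mult.commute[of Q] mult_left_mono)
qed simp

lemma fourier_series_cnj:
  assumes "fourier_series a A"
  shows "fourier_series (\<lambda>k. cnj (a (- k))) (\<lambda>x. cnj (A x))"
proof -
  have "trig (\<lambda>k. cnj (a (- k))) {- int n..int n} x = cnj (trig a {- int n..int n} x)" for n x
  proof -
    have "trig (\<lambda>k. cnj (a (- k))) {- int n..int n} x = (\<Sum>k\<in>{- int n..int n}. cnj (a (- k) * ech (- k) x))"
      by (simp add: trig_def ech_uminus)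
    also have "\<dots> = (\<Sum>k\<in>{- int n..int n}. cnj (a k * ech k x))"
      by (rule sum_symm_uminus)
    finally show ?thesis by (simp add: trig_def)
  qed
  moreover have "cmod (cnj z - cnj w) = cmod (z - w)" for z w
    by (simp flip: complex_cnj_diff)
  ultimately show ?thesis using assms by (simp add: fourier_series_def sq_int_cnj)
qed

text \<open>The conclusion with \<open>m\<close> says that C equals \<open>ech m\<close> times its
  conjugate, that is, that \<open>u\<close> is the character \<open>ech (- m)\<close>. This is never
  proved directly: a single nonvanishing coefficient of \<open>u\<close> is enough to produce
  \<open>m\<close>.\<close>

theorem reflection_of_triple_correlation:
  fixes c :: "int \<Rightarrow> real"
  assumes sm: "(\<lambda>k. (c k)\<^sup>2) summable_on UNIV"
    and C: "fourier_series (\<lambda>k. of_real (c k)) C"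
    and C0: "AE x in circ. C x \<noteq> 0"
    and T: "\<And>t s. (\<lambda>n. \<Sum>j\<in>{- int n..int n}. c j * c (j + t) * c (j + s)) \<longlonglongrightarrow> T t s"
    and T_sym: "\<And>t s. T (- t) (- s) = T t s"
  shows "\<exists>m. \<forall>j. c (m - j) = c j"
proof -
  define Q where "Q = infsum (\<lambda>k. (c k)\<^sup>2) UNIV"
  have Q: "(c k)\<^sup>2 \<le> Q" for k
    using finite_sum_le_infsum[OF sm, of "{k}"] by (simp add: Q_def)
  have sC: "sq_int C" using C by (simp add: fourier_series_def)
  have [measurable]: "C \<in> borel_measurable borel" using sq_int_measurable[OF sC] by simp
  have D: "fourier_series (\<lambda>k. of_real (c (- k))) (\<lambda>x. cnj (C x))"
    using fourier_series_cnj[OF C] by simp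
  define u where "u x = cnj (C x) / C x" for x
  have [measurable]: "u \<in> borel_measurable borel" unfolding u_def by measurable
  \<comment> \<open>At zeros of \<open>C\<close> division by zero gives \<open>u x = 0\<close>, so
    the bound holds everywhere and not just almost everywhere.\<close>
  have u_le: "cmod (u x) \<le> 1" for x by (simp add: u_def norm_divide)
  define U where "U m = (\<integral>x. u x * ech (- m) x \<partial>circ)" for m
  have U_le: "cmod (U m) \<le> 1" for m
  proof -
    have "cmod (U m) \<le> (\<integral>x. cmod (u x * ech (- m) x) \<partial>circ)"
      unfolding U_def by (rule integral_norm_bound)
    also have "\<dots> \<le> (\<integral>x. 1 \<partial>circ)"
    proof (rule integral_mono)
      show "integrable circ (\<lambda>x. cmod (u x * ech (- m) x))"
        using u_le by (intro circ.integrable_const_bound[where B = 1]) (auto simp: norm_mult)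
    qed (use u_le in \<open>auto simp: norm_mult\<close>)
    finally show ?thesis using circ.prob_space by simp
  qed
  \<comment> \<open>\<open>A\<close> is the transform of c(j) c(j+t), and \<open>A'\<close> that of
    the same product for the reflected sequence. Both \<open>A x * cnj (C x)\<close> and
    \<open>A' x * C x\<close> have the coefficients \<open>T t s\<close> in \<open>s\<close>, the
    second by \<open>T_sym\<close>. Division by \<open>C\<close> gives \<open>A' = A * u\<close>
    almost everywhere, and the coefficients with index \<open>k\<close> are compared.\<close>
  have key: "(\<lambda>n. \<Sum>j\<in>{- int n..int n}. complex_of_real (c j * c (j + t)) * U (k - j))
      \<longlonglongrightarrow> complex_of_real (c (- k) * c (- k - t))" for k t
  proof -
    obtain A where A: "fourier_series (\<lambda>j. of_real (c j) * of_real (c (j + t))) A"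
      using fourier_series_exists_bounded_mult[OF sm, of "\<lambda>j. of_real (c (j + t))" Q] Q by auto
    have sm': "(\<lambda>k. (c (- k))\<^sup>2) summable_on UNIV"
      using summable_on_reindex_bij_betw[OF bij_uminus, of "\<lambda>k. (c k)\<^sup>2"] sm by simp
    obtain A' where A': "fourier_series (\<lambda>j. of_real (c (- j)) * of_real (c (- j - t))) A'"
      using fourier_series_exists_bounded_mult[OF sm', of "\<lambda>j. of_real (c (- j - t))" Q] Q by auto
    have sA: "sq_int A" and sA': "sq_int A'" using A A' by (auto simp: fourier_series_def)
    have e1: "(\<integral>x. ech s x * (A x * cnj (C x)) \<partial>circ) = of_real (T t s)" for s
    proof (rule LIMSEQ_unique[OF fourier_series_parseval[OF A C]])
      show "(\<lambda>n. \<Sum>j\<in>{- int n..int n}. of_real (c j) * of_real (c (j + t)) * cnj (complex_of_real (c (j + s)))) \<longlonglongrightarrow> of_real (T t s)"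
        using tendsto_of_real[OF T[of t s], where 'a = complex] by simp
    qed
    have e2: "(\<integral>x. ech s x * (A' x * C x) \<partial>circ) = of_real (T t s)" for s
    proof -
      have "(\<lambda>n. \<Sum>j\<in>{- int n..int n}. of_real (c (- j)) * of_real (c (- j - t)) * cnj (complex_of_real (c (- (j + s)))))
           \<longlonglongrightarrow> of_real (T (- t) (- s))"
        using tendsto_of_real[OF T[of "- t" "- s"], where 'a = complex]
          sum_symm_uminus[of "\<lambda>j. complex_of_real (c j * c (j - t) * c (j - s))"]
        by (simp add: algebra_simps)
      from LIMSEQ_unique[OF fourier_series_parseval[OF A' D] this] show ?thesis
        by (simp add: T_sym)
    qed
    have i1: "integrable circ (\<lambda>x. A x * cnj (C x))" "integrable circ (\<lambda>x. A' x * C x)"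
      by (intro sq_int_mult sq_int_cnj sA sA' sC)+
    have "vanishing_fc (\<lambda>x. A x * cnj (C x) - A' x * C x)"
      unfolding vanishing_fc_def
    proof (intro conjI allI)
      fix s
      have "integrable circ (\<lambda>x. ech s x * (A x * cnj (C x)))" "integrable circ (\<lambda>x. ech s x * (A' x * C x))"
        by (intro integrable_bounded_mult[where C = 1] i1; simp)+
      then show "(\<integral>x. ech s x * (A x * cnj (C x) - A' x * C x) \<partial>circ) = 0"
        by (simp add: right_diff_distrib e1 e2)
    qed (intro Bochner_Integration.integrable_diff i1)
    then have "AE x in circ. A x * cnj (C x) - A' x * C x = 0" by (rule vanishing_fc_AE_0)
    with C0 have "AE x in circ. A' x * ech (- k) x = A x * (u x * ech (- k) x)"
      by eventually_elim (simp add: u_def field_simps)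
    then have "(\<integral>x. A' x * ech (- k) x \<partial>circ) = (\<integral>x. A x * (u x * ech (- k) x) \<partial>circ)"
      using sA sA' by (intro integral_cong_AE) auto
    then have e3: "of_real (c (- k) * c (- k - t)) = (\<integral>x. A x * (u x * ech (- k) x) \<partial>circ)"
      by (simp add: fourier_series_coeff[OF A'])
    have s: "sq_int (\<lambda>x. u x * ech (- k) x)"
      using u_le by (intro sq_int_bounded_mult[where C = 1]) auto
    have "(\<integral>x. ech j x * (u x * ech (- k) x) \<partial>circ) = U (k - j)" for j
      using ech_add[of j "- k"] by (simp add: U_def mult_ac)
    then show "(\<lambda>n. \<Sum>j\<in>{- int n..int n}. complex_of_real (c j * c (j + t)) * U (k - j)) \<longlonglongrightarrow> complex_of_real (c (- k) * c (- k - t))"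
      unfolding e3 using fourier_series_integral_mult[OF A s] by simp
  qed
  \<comment> \<open>For fixed \<open>k\<close>, \<open>key\<close> now reads as a statement in
    \<open>t\<close>: its left side is a cross-correlation of c(j) U(k-j) with c, conjugated below
    to fit Parseval's identity.\<close>
  have mult_U: "(c j - c (- k)) * U (k - j) = 0" for j k
  proof -
    obtain E where E: "fourier_series (\<lambda>j. of_real (c j) * cnj (U (k - j))) E"
      using fourier_series_exists_bounded_mult[OF sm, of "\<lambda>j. cnj (U (k - j))" 1] U_le
      by (auto simp: power_le_one)
    have sE: "sq_int E" using E by (simp add: fourier_series_def)
    \<comment> \<open>Chosen so that \<open>G x * cnj (C x)\<close> is
      \<open>c (- k) * ech k x * C x\<close> almost everywhere, because
      \<open>cnj (u x) * cnj (C x) = C x\<close>. Its coefficients are exactly the right side of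
      \<open>key\<close>.\<close>
    define G where "G x = of_real (c (- k)) * (cnj (u x) * ech k x)" for x
    have sG: "sq_int G" unfolding G_def
      using u_le by (intro sq_int_cmult sq_int_bounded_mult[where C = 1]) auto
    have e1: "(\<integral>x. ech t x * (E x * cnj (C x)) \<partial>circ) = of_real (c (- k) * c (- k - t))" for t
    proof (rule LIMSEQ_unique[OF fourier_series_parseval[OF E C]])
      show "(\<lambda>n. \<Sum>j\<in>{- int n..int n}. of_real (c j) * cnj (U (k - j)) * cnj (complex_of_real (c (j + t))))
          \<longlonglongrightarrow> of_real (c (- k) * c (- k - t))"
        using tendsto_cnj[OF key[of t k]] by (simp add: mult_ac)
    qed
    have e2: "(\<integral>x. ech t x * (G x * cnj (C x)) \<partial>circ) = of_real (c (- k) * c (- k - t))" for t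
    proof -
      have "(\<integral>x. ech t x * (G x * cnj (C x)) \<partial>circ) = (\<integral>x. of_real (c (- k)) * (C x * ech (- (- k - t)) x) \<partial>circ)"
      proof (rule integral_cong_AE)
        show "AE x in circ. ech t x * (G x * cnj (C x)) = of_real (c (- k)) * (C x * ech (- (- k - t)) x)"
          using C0
        proof eventually_elim
          case (elim x)
          then have "cnj (u x) * cnj (C x) = C x" by (simp add: u_def)
          then have "ech t x * (G x * cnj (C x)) = of_real (c (- k)) * (C x * (ech k x * ech t x))"
            by (simp add: G_def mult_ac)
          then show ?case by (simp add: add.commute flip: ech_add)
        qed
      qed (use sG in auto)
      also have "\<dots> = of_real (c (- k) * c (- k - t))"
        by (simp only: integral_mult_right_zero fourier_series_coeff[OF C] of_real_mult)
      finally show ?thesis .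
    qed
    have i1: "integrable circ (\<lambda>x. E x * cnj (C x))" "integrable circ (\<lambda>x. G x * cnj (C x))"
      by (intro sq_int_mult sq_int_cnj sE sG sC)+
    have "vanishing_fc (\<lambda>x. E x * cnj (C x) - G x * cnj (C x))"
      unfolding vanishing_fc_def
    proof (intro conjI allI)
      fix s
      have "integrable circ (\<lambda>x. ech s x * (E x * cnj (C x)))" "integrable circ (\<lambda>x. ech s x * (G x * cnj (C x)))"
        by (intro integrable_bounded_mult[where C = 1] i1; simp)+
      then show "(\<integral>x. ech s x * (E x * cnj (C x) - G x * cnj (C x)) \<partial>circ) = 0"
        by (simp add: right_diff_distrib e1 e2)
    qed (intro Bochner_Integration.integrable_diff i1)
    then have "AE x in circ. E x * cnj (C x) - G x * cnj (C x) = 0" by (rule vanishing_fc_AE_0)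
    with C0 have "AE x in circ. E x * ech (- j) x = G x * ech (- j) x"
      by eventually_elim simp
    then have "(\<integral>x. E x * ech (- j) x \<partial>circ) = (\<integral>x. G x * ech (- j) x \<partial>circ)"
      using sE sG by (intro integral_cong_AE) auto
    also have "\<dots> = (\<integral>x. of_real (c (- k)) * cnj (u x * ech (- (k - j)) x) \<partial>circ)"
      using ech_add[of k "- j"] by (simp add: G_def mult_ac flip: ech_uminus)
    also have "\<dots> = of_real (c (- k)) * cnj (U (k - j))"
      by (simp only: integral_mult_right_zero Bochner_Integration.integral_cnj U_def)
    finally have "of_real (c j) * cnj (U (k - j)) = of_real (c (- k)) * cnj (U (k - j))"
      by (simp add: fourier_series_coeff[OF E])
    then show ?thesis by auto
  qed
  \<comment> \<open>Otherwise \<open>u\<close> would vanish almost everywhere by uniqueness,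
    although it has modulus one wherever \<open>C\<close> is nonzero.\<close>
  have "\<exists>m. U m \<noteq> 0"
  proof (rule ccontr)
    assume "\<not> ?thesis"
    then have "U (- t) = 0" for t by simp
    moreover have "integrable circ u" using u_le by (intro sq_int_integrable sq_int_bounded) auto
    ultimately have "vanishing_fc u" by (simp add: vanishing_fc_def U_def mult.commute)
    then have "AE x in circ. u x = 0" by (rule vanishing_fc_AE_0)
    with C0 have "AE x in circ. False" by eventually_elim (simp add: u_def)
    then show False by simp
  qed
  then obtain m where "U m \<noteq> 0" by blast
  have "c (- m - j) = c j" for j
    using mult_U[of "- m - j" "- j"] \<open>U m \<noteq> 0\<close> by (simp add: algebra_simps)
  then show ?thesis by blast
qed

section \<open>Convergence of expectations of threefold products\<close>

text \<open>A weighted Young inequality that takes the place of Hoelder's with three exponents 3.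
  The factor \<open>a\<close>, meant to be small in third mean, gets the large weight, the others
  the small weight \<delta>. The proof compares \<open>a\<close> with \<delta> times the larger of
  \<open>b\<close> and \<open>c\<close>.\<close>

lemma mult3_le:
  fixes a b c \<delta> :: real
  assumes "a \<ge> 0" "b \<ge> 0" "c \<ge> 0" "\<delta> > 0"
  shows "a * b * c \<le> a ^ 3 / \<delta>\<^sup>2 + \<delta> * (b ^ 3 + c ^ 3)"
proof -
  define m where "m = max b c"
  have m: "m \<ge> 0" "b \<le> m" "c \<le> m" using assms by (auto simp: m_def)
  have "b * c \<le> m * m" using m assms by (intro mult_mono) auto
  then have abc: "a * b * c \<le> a * m\<^sup>2"
    using assms by (simp add: mult.assoc power2_eq_square mult_left_mono)
  have m3: "m ^ 3 \<le> b ^ 3 + c ^ 3" using assms by (auto simp: m_def max_def)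
  show ?thesis
  proof (cases "a \<le> \<delta> * m")
    case True
    then have "a * m\<^sup>2 \<le> \<delta> * m * m\<^sup>2" by (intro mult_right_mono) auto
    also have "\<dots> = \<delta> * m ^ 3" by (simp add: power2_eq_square power3_eq_cube)
    also have "\<dots> \<le> \<delta> * (b ^ 3 + c ^ 3)" using m3 assms by (intro mult_left_mono) auto
    finally have "a * m\<^sup>2 \<le> \<delta> * (b ^ 3 + c ^ 3)" .
    moreover have "0 \<le> a ^ 3 / \<delta>\<^sup>2" using assms by simp
    ultimately show ?thesis using abc by linarith
  next
    case False
    then have "m \<le> a / \<delta>" using assms by (simp add: field_simps)
    then have "a * m\<^sup>2 \<le> a * (a / \<delta>)\<^sup>2" using m assms by (intro mult_left_mono power_mono) auto
    also have "\<dots> = a ^ 3 / \<delta>\<^sup>2" by (simp add: power2_eq_square power3_eq_cube)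
    finally have "a * m\<^sup>2 \<le> a ^ 3 / \<delta>\<^sup>2" .
    moreover have "0 \<le> \<delta> * (b ^ 3 + c ^ 3)" using assms by simp
    ultimately show ?thesis using abc by linarith
  qed
qed

lemma abs_add_cube_le:
  fixes x y :: real
  shows "\<bar>x + y\<bar> ^ 3 \<le> 8 * (\<bar>x\<bar> ^ 3 + \<bar>y\<bar> ^ 3)"
proof -
  have "\<bar>x + y\<bar> ^ 3 \<le> (2 * max \<bar>x\<bar> \<bar>y\<bar>) ^ 3" by (intro power_mono) auto
  also have "\<dots> \<le> 8 * (\<bar>x\<bar> ^ 3 + \<bar>y\<bar> ^ 3)" by (auto simp: power_mult_distrib max_def)
  finally show ?thesis .
qed

text \<open>Taylor expansion of the cubed absolute value at \<open>x\<close> with remainder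
  \<open>\<bar>y\<bar> ^ 3\<close>. The first-order term is kept linear in \<open>y\<close>, signs
  included, so that its expectation vanishes for an independent centred \<open>y\<close>.\<close>

lemma abs_add_cube_taylor_nonneg:
  fixes x y :: real
  assumes "x \<ge> 0"
  shows "\<bar>x + y\<bar> ^ 3 \<le> \<bar>x\<bar> ^ 3 + 3 * (x * \<bar>x\<bar>) * y + 3 * \<bar>x\<bar> * y\<^sup>2 + \<bar>y\<bar> ^ 3"
proof (cases "y \<ge> 0")
  case True
  then show ?thesis using assms by (simp add: power2_eq_square power3_eq_cube algebra_simps)
next
  case False
  define w where "w = - y"
  have w: "w \<ge> 0" "y = - w" using False by (auto simp: w_def)
  show ?thesis
  proof (cases "w \<le> x")
    case True
    have "0 \<le> w ^ 3" using w by simp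
    then show ?thesis using assms w True by (simp add: power2_eq_square power3_eq_cube algebra_simps)
  next
    case False
    \<comment> \<open>For \<open>w > x\<close> the two sides differ by
      \<open>2 * x * (x\<^sup>2 - 3 * x * w + 3 * w\<^sup>2)\<close>; the quadratic form is written
      as a sum of squares.\<close>
    have "0 \<le> 2 * x * ((x - 3 / 2 * w)\<^sup>2 + 3 / 4 * w\<^sup>2)" using assms by simp
    then show ?thesis using assms w False by (simp add: power2_eq_square power3_eq_cube algebra_simps)
  qed
qed

lemma abs_add_cube_taylor:
  fixes x y :: real
  shows "\<bar>x + y\<bar> ^ 3 \<le> \<bar>x\<bar> ^ 3 + 3 * (x * \<bar>x\<bar>) * y + 3 * \<bar>x\<bar> * y\<^sup>2 + \<bar>y\<bar> ^ 3"
proof (cases "x \<ge> 0")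
  case False
  then show ?thesis
    using abs_add_cube_taylor_nonneg[of "- x" "- y"] by (simp add: abs_minus_commute[of "- x" y] add.commute)
qed (rule abs_add_cube_taylor_nonneg)

section \<open>Convergence in third mean and products of three factors\<close>

definition cube_int :: "'a measure \<Rightarrow> ('a \<Rightarrow> real) \<Rightarrow> bool" where
  "cube_int M g \<longleftrightarrow> g \<in> borel_measurable M \<and> integrable M (\<lambda>x. \<bar>g x\<bar> ^ 3)"

lemma cube_int_measurable [measurable_dest]: "cube_int M g \<Longrightarrow> g \<in> borel_measurable M"
  by (simp add: cube_int_def)

lemma cube_int_add:
  assumes f: "cube_int M f" and g: "cube_int M g"
  shows "cube_int M (\<lambda>x. f x + g x)"
proof -
  have "integrable M (\<lambda>x. \<bar>f x + g x\<bar> ^ 3)"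
  proof (rule Bochner_Integration.integrable_bound)
    show "integrable M (\<lambda>x. 8 * (\<bar>f x\<bar> ^ 3 + \<bar>g x\<bar> ^ 3))"
      using f g by (simp add: cube_int_def)
    show "AE x in M. norm (\<bar>f x + g x\<bar> ^ 3) \<le> norm (8 * (\<bar>f x\<bar> ^ 3 + \<bar>g x\<bar> ^ 3))"
      using abs_add_cube_le by (auto simp: power_abs[symmetric])
  qed (use f g in measurable)
  moreover have "(\<lambda>x. f x + g x) \<in> borel_measurable M" using f g by measurable
  ultimately show ?thesis by (simp add: cube_int_def)
qed

lemma cube_int_cmult: "cube_int M g \<Longrightarrow> cube_int M (\<lambda>x. c * g x)"
  by (auto simp: cube_int_def abs_mult power_mult_distrib)

lemma cube_int_diff:
  assumes "cube_int M f" "cube_int M g"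
  shows "cube_int M (\<lambda>x. f x - g x)"
  using cube_int_add[OF assms(1) cube_int_cmult[OF assms(2), of "-1"]] by simp

lemma cube_int_mult3:
  assumes f: "cube_int M f" and g: "cube_int M g" and h: "cube_int M h"
  shows "integrable M (\<lambda>x. f x * g x * h x)"
proof (rule Bochner_Integration.integrable_bound)
  show "integrable M (\<lambda>x. \<bar>f x\<bar> ^ 3 / 1\<^sup>2 + 1 * (\<bar>g x\<bar> ^ 3 + \<bar>h x\<bar> ^ 3))"
    using f g h by (simp add: cube_int_def)
  show "AE x in M. norm (f x * g x * h x) \<le> norm (\<bar>f x\<bar> ^ 3 / 1\<^sup>2 + 1 * (\<bar>g x\<bar> ^ 3 + \<bar>h x\<bar> ^ 3))"
  proof (rule AE_I2)
    fix x
    have "norm (f x * g x * h x) \<le> \<bar>f x\<bar> ^ 3 / 1\<^sup>2 + 1 * (\<bar>g x\<bar> ^ 3 + \<bar>h x\<bar> ^ 3)"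
      using mult3_le[of "\<bar>f x\<bar>" "\<bar>g x\<bar>" "\<bar>h x\<bar>" 1] by (simp add: abs_mult)
    then show "norm (f x * g x * h x) \<le> norm (\<bar>f x\<bar> ^ 3 / 1\<^sup>2 + 1 * (\<bar>g x\<bar> ^ 3 + \<bar>h x\<bar> ^ 3))" by simp
  qed
qed (use f g h in measurable)

lemma tendsto_integral_mult3_zero:
  assumes r: "\<And>n. cube_int M (r n)" and y: "\<And>n. cube_int M (y n)" and z: "\<And>n. cube_int M (z n)"
    and r0: "(\<lambda>n. \<integral>x. \<bar>r n x\<bar> ^ 3 \<partial>M) \<longlonglongrightarrow> 0"
    and yK: "eventually (\<lambda>n. (\<integral>x. \<bar>y n x\<bar> ^ 3 \<partial>M) \<le> K) sequentially"
    and zK: "eventually (\<lambda>n. (\<integral>x. \<bar>z n x\<bar> ^ 3 \<partial>M) \<le> L) sequentially"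
  shows "(\<lambda>n. \<integral>x. r n x * y n x * z n x \<partial>M) \<longlonglongrightarrow> 0"
proof (rule LIMSEQ_I)
  fix e :: real assume "e > 0"
  \<comment> \<open>A strictly positive majorant of \<open>K + L\<close>, whatever the signs of
    \<open>K\<close> and \<open>L\<close>. With \<delta> scaled by it, the two bounded factors
    contribute at most half of \<open>e\<close>.\<close>
  define H where "H = \<bar>K + L\<bar> + 1"
  have H: "H > 0" "K + L \<le> H" by (auto simp: H_def)
  define \<delta> where "\<delta> = e / (2 * H)"
  have \<delta>: "\<delta> > 0" "\<delta> * H = e / 2" using \<open>e > 0\<close> H by (auto simp: \<delta>_def)
  have "eventually (\<lambda>n. (\<integral>x. \<bar>r n x\<bar> ^ 3 \<partial>M) < \<delta>\<^sup>2 * (e / 2)) sequentially"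
    using \<delta> \<open>e > 0\<close> by (intro order_tendstoD(2)[OF r0]) auto
  with yK zK have "eventually (\<lambda>n. norm ((\<integral>x. r n x * y n x * z n x \<partial>M) - 0) < e) sequentially"
  proof eventually_elim
    case (elim n)
    have i: "integrable M (\<lambda>x. \<bar>r n x\<bar> ^ 3)" "integrable M (\<lambda>x. \<bar>y n x\<bar> ^ 3)" "integrable M (\<lambda>x. \<bar>z n x\<bar> ^ 3)"
      using r[of n] y[of n] z[of n] by (auto simp: cube_int_def)
    have "\<bar>\<integral>x. r n x * y n x * z n x \<partial>M\<bar> \<le> (\<integral>x. \<bar>r n x * y n x * z n x\<bar> \<partial>M)"
      by (rule integral_abs_bound)
    also have "\<dots> \<le> (\<integral>x. \<bar>r n x\<bar> ^ 3 / \<delta>\<^sup>2 + \<delta> * (\<bar>y n x\<bar> ^ 3 + \<bar>z n x\<bar> ^ 3) \<partial>M)"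
    proof (rule integral_mono)
      show "integrable M (\<lambda>x. \<bar>r n x * y n x * z n x\<bar>)"
        by (intro integrable_abs cube_int_mult3 r y z)
      show "\<bar>r n x * y n x * z n x\<bar> \<le> \<bar>r n x\<bar> ^ 3 / \<delta>\<^sup>2 + \<delta> * (\<bar>y n x\<bar> ^ 3 + \<bar>z n x\<bar> ^ 3)" for x
        using mult3_le[of "\<bar>r n x\<bar>" "\<bar>y n x\<bar>" "\<bar>z n x\<bar>" \<delta>] \<delta> by (simp add: abs_mult)
    qed (use i in auto)
    also have "\<dots> = (\<integral>x. \<bar>r n x\<bar> ^ 3 \<partial>M) / \<delta>\<^sup>2 + \<delta> * ((\<integral>x. \<bar>y n x\<bar> ^ 3 \<partial>M) + (\<integral>x. \<bar>z n x\<bar> ^ 3 \<partial>M))"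
      using i by simp
    also have "\<dots> < e / 2 + \<delta> * H"
    proof (rule add_less_le_mono)
      show "(\<integral>x. \<bar>r n x\<bar> ^ 3 \<partial>M) / \<delta>\<^sup>2 < e / 2"
        using elim(3) \<delta> by (simp add: divide_less_eq mult.commute)
      show "\<delta> * ((\<integral>x. \<bar>y n x\<bar> ^ 3 \<partial>M) + (\<integral>x. \<bar>z n x\<bar> ^ 3 \<partial>M)) \<le> \<delta> * H"
        using elim(1,2) H \<delta> by (intro mult_left_mono) auto
    qed
    also have "\<dots> = e" using \<delta> by simp
    finally show ?case by simp
  qed
  then show "\<exists>no. \<forall>n\<ge>no. norm ((\<integral>x. r n x * y n x * z n x \<partial>M) - 0) < e"
    by (simp add: eventually_sequentially)
qed

lemma eventually_cube_bounded:
  assumes fn: "\<And>n. cube_int M (fn n)" and f: "cube_int M f"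
    and lim: "(\<lambda>n. \<integral>x. \<bar>fn n x - f x\<bar> ^ 3 \<partial>M) \<longlonglongrightarrow> 0"
  shows "eventually (\<lambda>n. (\<integral>x. \<bar>fn n x\<bar> ^ 3 \<partial>M) \<le> 8 * (1 + (\<integral>x. \<bar>f x\<bar> ^ 3 \<partial>M))) sequentially"
proof -
  have "eventually (\<lambda>n. (\<integral>x. \<bar>fn n x - f x\<bar> ^ 3 \<partial>M) < 1) sequentially"
    by (rule order_tendstoD(2)[OF lim]) simp
  then show ?thesis
  proof eventually_elim
    case (elim n)
    have i: "integrable M (\<lambda>x. \<bar>fn n x - f x\<bar> ^ 3)" "integrable M (\<lambda>x. \<bar>f x\<bar> ^ 3)"
      using cube_int_diff[OF fn[of n] f] f by (auto simp: cube_int_def)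
    have "(\<integral>x. \<bar>fn n x\<bar> ^ 3 \<partial>M) \<le> (\<integral>x. 8 * (\<bar>fn n x - f x\<bar> ^ 3 + \<bar>f x\<bar> ^ 3) \<partial>M)"
      using fn[of n] i abs_add_cube_le[of "fn n x - f x" "f x" for x]
      by (intro integral_mono) (auto simp: cube_int_def)
    also have "\<dots> = 8 * ((\<integral>x. \<bar>fn n x - f x\<bar> ^ 3 \<partial>M) + (\<integral>x. \<bar>f x\<bar> ^ 3 \<partial>M))" using i by simp
    also have "\<dots> \<le> 8 * (1 + (\<integral>x. \<bar>f x\<bar> ^ 3 \<partial>M))" using elim by simp
    finally show ?case .
  qed
qed

lemma tendsto_integral_mult3:
  assumes fn: "\<And>n. cube_int M (fn n)" and f: "cube_int M f" and fl: "(\<lambda>n. \<integral>x. \<bar>fn n x - f x\<bar> ^ 3 \<partial>M) \<longlonglongrightarrow> 0"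
    and gn: "\<And>n. cube_int M (gn n)" and g: "cube_int M g" and gl: "(\<lambda>n. \<integral>x. \<bar>gn n x - g x\<bar> ^ 3 \<partial>M) \<longlonglongrightarrow> 0"
    and hn: "\<And>n. cube_int M (hn n)" and h: "cube_int M h" and hl: "(\<lambda>n. \<integral>x. \<bar>hn n x - h x\<bar> ^ 3 \<partial>M) \<longlonglongrightarrow> 0"
  shows "(\<lambda>n. \<integral>x. fn n x * gn n x * hn n x \<partial>M) \<longlonglongrightarrow> (\<integral>x. f x * g x * h x \<partial>M)"
proof -
  note bg = eventually_cube_bounded[OF gn g gl] and bh = eventually_cube_bounded[OF hn h hl]
  have c: "eventually (\<lambda>n::nat. (\<integral>x. \<bar>k x\<bar> ^ 3 \<partial>M) \<le> (\<integral>x. \<bar>k x\<bar> ^ 3 \<partial>M)) sequentially" for k :: "'a \<Rightarrow> real"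
    by simp
  have df: "cube_int M (\<lambda>x. fn n x - f x)" and dg: "cube_int M (\<lambda>x. gn n x - g x)"
    and dh: "cube_int M (\<lambda>x. hn n x - h x)" for n
    by (intro cube_int_diff fn f gn g hn h)+
  \<comment> \<open>Telescoping: the factors are exchanged one at a time, and in each term one
    difference tends to zero in third mean while the other two factors stay bounded.\<close>
  have "(\<lambda>n. (\<integral>x. (fn n x - f x) * gn n x * hn n x \<partial>M) + (\<integral>x. (gn n x - g x) * f x * hn n x \<partial>M)
      + (\<integral>x. (hn n x - h x) * f x * g x \<partial>M)) \<longlonglongrightarrow> 0 + 0 + 0"
    by (intro tendsto_add tendsto_integral_mult3_zero[OF df gn hn fl bg bh]
        tendsto_integral_mult3_zero[OF dg f hn gl c bh] tendsto_integral_mult3_zero[OF dh f g hl c c])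
  also have "(\<lambda>n. (\<integral>x. (fn n x - f x) * gn n x * hn n x \<partial>M) + (\<integral>x. (gn n x - g x) * f x * hn n x \<partial>M)
      + (\<integral>x. (hn n x - h x) * f x * g x \<partial>M)) =
     (\<lambda>n. (\<integral>x. fn n x * gn n x * hn n x \<partial>M) - (\<integral>x. f x * g x * h x \<partial>M))"
  proof
    fix n
    have "(\<integral>x. (fn n x - f x) * gn n x * hn n x \<partial>M) + (\<integral>x. (gn n x - g x) * f x * hn n x \<partial>M)
      + (\<integral>x. (hn n x - h x) * f x * g x \<partial>M) =
      (\<integral>x. (fn n x - f x) * gn n x * hn n x + (gn n x - g x) * f x * hn n x + (hn n x - h x) * f x * g x \<partial>M)"
      by (simp add: cube_int_mult3 df dg dh fn f gn g hn h)
    also have "\<dots> = (\<integral>x. fn n x * gn n x * hn n x - f x * g x * h x \<partial>M)"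
      by (simp add: algebra_simps)
    also have "\<dots> = (\<integral>x. fn n x * gn n x * hn n x \<partial>M) - (\<integral>x. f x * g x * h x \<partial>M)"
      by (simp add: cube_int_mult3 fn f gn g hn h)
    finally show "(\<integral>x. (fn n x - f x) * gn n x * hn n x \<partial>M) + (\<integral>x. (gn n x - g x) * f x * hn n x \<partial>M)
      + (\<integral>x. (hn n x - h x) * f x * g x \<partial>M) =
      (\<integral>x. fn n x * gn n x * hn n x \<partial>M) - (\<integral>x. f x * g x * h x \<partial>M)" .
  qed
  finally show ?thesis by (simp add: LIM_zero_iff)
qed

section \<open>Moving averages of independent variables\<close>

locale iid_seq = prob_space M for M :: "'a measure" +
  fixes Z :: "int \<Rightarrow> 'a \<Rightarrow> real"
  assumes indep: "indep_vars (\<lambda>_. borel) Z UNIV"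
    and ident: "\<And>t. distr M borel (Z t) = distr M borel (Z 0)"
    and sq_integrable: "integrable M (\<lambda>\<omega>. (Z 0 \<omega>)\<^sup>2)"
    and mean_zero: "expectation (Z 0) = 0"
begin

lemma Z_measurable [measurable]: "Z t \<in> borel_measurable M"
  using indep by (auto simp: indep_vars_def)

lemma integrable_transfer:
  fixes g :: "real \<Rightarrow> real"
  assumes [measurable]: "g \<in> borel_measurable borel"
  shows "integrable M (\<lambda>\<omega>. g (Z s \<omega>)) \<longleftrightarrow> integrable M (\<lambda>\<omega>. g (Z t \<omega>))"
proof -
  have "integrable M (\<lambda>\<omega>. g (Z r \<omega>)) \<longleftrightarrow> integrable (distr M borel (Z 0)) g" for r
    using integrable_distr_eq[of "Z r" M borel g] by (simp add: ident[of r])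
  then show ?thesis by blast
qed

lemma expectation_transfer:
  fixes g :: "real \<Rightarrow> real"
  assumes [measurable]: "g \<in> borel_measurable borel"
  shows "expectation (\<lambda>\<omega>. g (Z t \<omega>)) = expectation (\<lambda>\<omega>. g (Z 0 \<omega>))"
proof -
  have "expectation (\<lambda>\<omega>. g (Z r \<omega>)) = integral\<^sup>L (distr M borel (Z 0)) g" for r
    using integral_distr[of "Z r" M borel g] by (simp add: ident[of r])
  then show ?thesis by simp
qed

definition "variance_Z = expectation (\<lambda>\<omega>. (Z 0 \<omega>)\<^sup>2)"

lemma Z_sq: "integrable M (\<lambda>\<omega>. (Z t \<omega>)\<^sup>2)" "expectation (\<lambda>\<omega>. (Z t \<omega>)\<^sup>2) = variance_Z"
  using sq_integrable integrable_transfer[of "\<lambda>x. x\<^sup>2" t 0] expectation_transfer[of "\<lambda>x. x\<^sup>2" t]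
  by (auto simp: variance_Z_def)

lemma Z_integrable: "integrable M (Z t)"
  by (rule square_integrable_imp_integrable) (use Z_sq in auto)

lemma Z_mean: "expectation (Z t) = 0"
  using expectation_transfer[of "\<lambda>x. x" t] mean_zero by simp

lemma variance_Z_nonneg: "variance_Z \<ge> 0"
  by (simp add: variance_Z_def)

definition wsum :: "(int \<Rightarrow> real) \<Rightarrow> int set \<Rightarrow> 'a \<Rightarrow> real" where
  "wsum a K \<omega> = (\<Sum>j\<in>K. a j * Z j \<omega>)"

lemma wsum_measurable [measurable]: "wsum a K \<in> borel_measurable M"
  unfolding wsum_def by measurable

lemma wsum_insert: "finite K \<Longrightarrow> i \<notin> K \<Longrightarrow> wsum a (insert i K) \<omega> = wsum a K \<omega> + a i * Z i \<omega>"
  by (simp add: wsum_def)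

text \<open>The partial sum and the new term are functions of disjoint blocks of the family. This is
  what drives the inductions on moments, which add one innovation at a time.\<close>

lemma indep_wsum:
  assumes "finite K" "i \<notin> K"
  shows "indep_var borel (wsum a K) borel (\<lambda>\<omega>. a i * Z i \<omega>)"
proof -
  have "indep_var (PiM K (\<lambda>_. borel)) (\<lambda>\<omega>. restrict (\<lambda>j. Z j \<omega>) K) (PiM {i} (\<lambda>_. borel)) (\<lambda>\<omega>. restrict (\<lambda>j. Z j \<omega>) {i})"
    using assms by (intro indep_var_restrict[OF indep]) auto
  then have "indep_var borel ((\<lambda>z. \<Sum>j\<in>K. a j * z j) \<circ> (\<lambda>\<omega>. restrict (\<lambda>j. Z j \<omega>) K)) borel
      ((\<lambda>z. a i * z i) \<circ> (\<lambda>\<omega>. restrict (\<lambda>j. Z j \<omega>) {i}))"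
    by (rule indep_var_compose) auto
  then show ?thesis by (simp add: comp_def wsum_def[abs_def])
qed

lemma wsum_moments:
  assumes "finite K"
  shows "integrable M (\<lambda>\<omega>. (wsum a K \<omega>)\<^sup>2) \<and> expectation (\<lambda>\<omega>. (wsum a K \<omega>)\<^sup>2) = variance_Z * (\<Sum>j\<in>K. (a j)\<^sup>2)"
  using assms
proof (induction K)
  case empty
  then show ?case by (simp add: wsum_def)
next
  case (insert i K)
  have S: "integrable M (wsum a K)"
    by (rule square_integrable_imp_integrable) (use insert in auto)
  have Y: "integrable M (\<lambda>\<omega>. a i * Z i \<omega>)" using Z_integrable by simp
  note ind = indep_wsum[OF insert(1,2)]
  have "expectation (\<lambda>\<omega>. wsum a K \<omega> * (a i * Z i \<omega>)) = 0"
    using indep_var_lebesgue_integral[OF ind S Y] Z_mean by simp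
  moreover have "integrable M (\<lambda>\<omega>. wsum a K \<omega> * (a i * Z i \<omega>))"
    by (rule indep_var_integrable[OF ind S Y])
  moreover have "(wsum a (insert i K) \<omega>)\<^sup>2 =
      (wsum a K \<omega>)\<^sup>2 + 2 * (wsum a K \<omega> * (a i * Z i \<omega>)) + (a i)\<^sup>2 * (Z i \<omega>)\<^sup>2" for \<omega>
    by (simp add: wsum_insert insert(1,2) power2_eq_square algebra_simps)
  ultimately show ?case
    using insert Z_sq[of i] by (simp add: algebra_simps del: mult.assoc)
qed

lemma expectation_Z2:
  "expectation (\<lambda>\<omega>. Z i \<omega> * Z j \<omega>) = (if i = j then variance_Z else 0)"
proof (cases "i = j")
  case True
  then show ?thesis using Z_sq[of i] by (simp add: power2_eq_square)
next
  case False
  then have "indep_var borel (wsum (\<lambda>_. 1) {i}) borel (\<lambda>\<omega>. 1 * Z j \<omega>)"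
    using indep_wsum[of "{i}" j "\<lambda>_. 1"] by auto
  then have "indep_var borel (Z i) borel (Z j)" by (simp add: wsum_def[abs_def])
  then show ?thesis
    using indep_var_lebesgue_integral[OF _ Z_integrable Z_integrable] Z_mean False by simp
qed

end

lemma sum_mult3:
  fixes f :: "'i \<Rightarrow> 'r :: semiring_0" and g :: "'j \<Rightarrow> 'r" and h :: "'k \<Rightarrow> 'r"
  shows "sum f A * sum g B * sum h C = (\<Sum>i\<in>A. \<Sum>j\<in>B. \<Sum>l\<in>C. f i * g j * h l)"
  by (simp only: mult.assoc sum_distrib_right) (simp only: sum_distrib_left mult.assoc)

(* By Fubini, v + U has a finite third moment for almost every value v of V. *)
lemma (in prob_space) cube_integrable_summand:
  fixes U V :: "'a \<Rightarrow> real"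
  assumes ind: "indep_var borel V borel U" and int: "integrable M (\<lambda>\<omega>. \<bar>V \<omega> + U \<omega>\<bar> ^ 3)"
  shows "integrable M (\<lambda>\<omega>. \<bar>U \<omega>\<bar> ^ 3)"
proof -
  have [measurable]: "V \<in> borel_measurable M" "U \<in> borel_measurable M"
    using indep_var_rv1[OF ind] indep_var_rv2[OF ind] by auto
  interpret V: prob_space "distr M borel V" by (rule prob_space_distr) simp
  interpret U: prob_space "distr M borel U" by (rule prob_space_distr) simp
  interpret P: pair_prob_space "distr M borel V" "distr M borel U" ..
  have "integrable (distr M (borel \<Otimes>\<^sub>M borel) (\<lambda>\<omega>. (V \<omega>, U \<omega>))) (\<lambda>p. \<bar>fst p + snd p\<bar> ^ 3)"
    using int integrable_distr_eq[of "\<lambda>\<omega>. (V \<omega>, U \<omega>)" M "borel \<Otimes>\<^sub>M borel" "\<lambda>p. \<bar>fst p + snd p\<bar> ^ 3"]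
    by simp
  then have "integrable (distr M borel V \<Otimes>\<^sub>M distr M borel U) (\<lambda>p. \<bar>fst p + snd p\<bar> ^ 3)"
    using ind unfolding indep_var_distribution_eq by simp
  then have "AE v in distr M borel V. integrable (distr M borel U) (\<lambda>u. \<bar>v + u\<bar> ^ 3)"
    by (simp only: P.AE_integrable_fst'[where f = "\<lambda>p. \<bar>fst p + snd p\<bar> ^ 3", unfolded fst_conv snd_conv])
  from eventually_happens'[OF V.ae_filter_bot this]
  obtain v where "integrable (distr M borel U) (\<lambda>u. \<bar>v + u\<bar> ^ 3)" ..
  then have v: "integrable M (\<lambda>\<omega>. \<bar>v + U \<omega>\<bar> ^ 3)"
    using integrable_distr_eq[of U M borel "\<lambda>u. \<bar>v + u\<bar> ^ 3"] by simp
  show ?thesis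
  proof (rule Bochner_Integration.integrable_bound)
    show "integrable M (\<lambda>\<omega>. 8 * (\<bar>v + U \<omega>\<bar> ^ 3 + \<bar>- v\<bar> ^ 3))" using v by simp
    show "AE \<omega> in M. norm (\<bar>U \<omega>\<bar> ^ 3) \<le> norm (8 * (\<bar>v + U \<omega>\<bar> ^ 3 + \<bar>- v\<bar> ^ 3))"
    proof (rule AE_I2)
      fix \<omega>
      show "norm (\<bar>U \<omega>\<bar> ^ 3) \<le> norm (8 * (\<bar>v + U \<omega>\<bar> ^ 3 + \<bar>- v\<bar> ^ 3))"
        using abs_add_cube_le[of "v + U \<omega>" "- v"] by simp
    qed
  qed simp
qed

section \<open>Third moments of innovations and of moving averages\<close>

locale moving_average = iid_seq +
  fixes c :: "int \<Rightarrow> real" and X :: "int \<Rightarrow> 'a \<Rightarrow> real"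
  assumes X_measurable [measurable]: "\<And>t. X t \<in> borel_measurable M"
    and c_summable: "(\<lambda>k. (c k)\<^sup>2) summable_on UNIV"
    and X_lim: "\<And>t. AE \<omega> in M. (\<lambda>n. \<Sum>k\<in>{- int n..int n}. c k * Z (t - k) \<omega>) \<longlonglongrightarrow> X t \<omega>"
begin

text \<open>One summand with a nonzero coefficient is split off: \<open>X 0\<close> is
  \<open>U\<close> plus an independent remainder \<open>V\<close>, and a finite third moment of the
  sum descends to \<open>U\<close>.\<close>

lemma Z_cube_integrable:
  assumes X3: "integrable M (\<lambda>\<omega>. \<bar>X 0 \<omega>\<bar> ^ 3)" and k0: "c k0 \<noteq> 0"
  shows "integrable M (\<lambda>\<omega>. \<bar>Z 0 \<omega>\<bar> ^ 3)"
proof -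
  define B where "B = - {- k0}"
  \<comment> \<open>The remainder is written as a measurable function of the innovations other than
    \<open>Z (- k0)\<close>. An almost sure limit by itself would not display the independence from
    \<open>U\<close>.\<close>
  define g where "g z = lim (\<lambda>n. \<Sum>k\<in>{- int n..int n} - {k0}. c k * z (- k))" for z :: "int \<Rightarrow> real"
  have [measurable]: "g \<in> borel_measurable (PiM B (\<lambda>_. borel))"
    unfolding g_def
  proof (rule borel_measurable_lim_metric, rule borel_measurable_sum)
    fix n k assume "k \<in> {- int n..int n} - {k0}"
    then have "- k \<in> B" by (auto simp: B_def)
    then show "(\<lambda>z. c k * z (- k)) \<in> borel_measurable (PiM B (\<lambda>_. borel))" by simp
  qed
  define V where "V \<omega> = g (\<lambda>j\<in>B. Z j \<omega>)" for \<omega>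
  define U where "U \<omega> = c k0 * Z (- k0) \<omega>" for \<omega>
  have "indep_var (PiM B (\<lambda>_. borel)) (\<lambda>\<omega>. restrict (\<lambda>i. Z i \<omega>) B) (PiM {- k0} (\<lambda>_. borel)) (\<lambda>\<omega>. restrict (\<lambda>i. Z i \<omega>) {- k0})"
    by (rule indep_var_restrict[OF indep]) (auto simp: B_def)
  then have "indep_var borel (g \<circ> (\<lambda>\<omega>. restrict (\<lambda>i. Z i \<omega>) B)) borel
     ((\<lambda>z. c k0 * z (- k0)) \<circ> (\<lambda>\<omega>. restrict (\<lambda>i. Z i \<omega>) {- k0}))"
    by (rule indep_var_compose) auto
  then have ind: "indep_var borel V borel U"
    by (simp add: comp_def V_def[abs_def] U_def[abs_def])
  have [measurable]: "V \<in> borel_measurable M" "U \<in> borel_measurable M"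
    using indep_var_rv1[OF ind] indep_var_rv2[OF ind] by auto
  have "AE \<omega> in M. X 0 \<omega> = V \<omega> + U \<omega>"
    using X_lim[of 0]
  proof eventually_elim
    case (elim \<omega>)
    then have "(\<lambda>n. (\<Sum>k\<in>{- int n..int n}. c k * Z (- k) \<omega>) - U \<omega>) \<longlonglongrightarrow> X 0 \<omega> - U \<omega>"
      by (intro tendsto_intros) simp
    moreover have "eventually (\<lambda>n. (\<Sum>k\<in>{- int n..int n}. c k * Z (- k) \<omega>) - U \<omega> =
        (\<Sum>k\<in>{- int n..int n} - {k0}. c k * Z (- k) \<omega>)) sequentially"
      using eventually_ge_at_top[of "nat \<bar>k0\<bar>"]
    proof eventually_elim
      case (elim n)
      then have "k0 \<in> {- int n..int n}" by auto
      then show ?case by (simp add: sum_diff1 U_def)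
    qed
    ultimately have "(\<lambda>n. \<Sum>k\<in>{- int n..int n} - {k0}. c k * Z (- k) \<omega>) \<longlonglongrightarrow> X 0 \<omega> - U \<omega>"
      by (simp add: tendsto_cong)
    moreover have "(\<Sum>k\<in>{- int n..int n} - {k0}. c k * Z (- k) \<omega>) =
        (\<Sum>k\<in>{- int n..int n} - {k0}. c k * (\<lambda>j\<in>B. Z j \<omega>) (- k))" for n
      by (rule sum.cong) (auto simp: B_def)
    ultimately have "V \<omega> = X 0 \<omega> - U \<omega>" by (simp add: V_def g_def limI)
    then show ?case by simp
  qed
  then have "integrable M (\<lambda>\<omega>. \<bar>X 0 \<omega>\<bar> ^ 3) \<longleftrightarrow> integrable M (\<lambda>\<omega>. \<bar>V \<omega> + U \<omega>\<bar> ^ 3)"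
    by (intro integrable_cong_AE) auto
  with X3 have "integrable M (\<lambda>\<omega>. \<bar>U \<omega>\<bar> ^ 3)"
    using cube_integrable_summand[OF ind] by simp
  then have "integrable M (\<lambda>\<omega>. \<bar>Z (- k0) \<omega>\<bar> ^ 3)"
    using k0 by (simp add: U_def abs_mult power_mult_distrib)
  then show ?thesis using integrable_transfer[of "\<lambda>x. \<bar>x\<bar> ^ 3" "- k0" 0] by simp
qed

end

locale iid_cube = iid_seq +
  assumes cube_integrable: "integrable M (\<lambda>\<omega>. \<bar>Z 0 \<omega>\<bar> ^ 3)"
begin

definition "cube_Z = expectation (\<lambda>\<omega>. \<bar>Z 0 \<omega>\<bar> ^ 3)"
definition "kappa = expectation (\<lambda>\<omega>. (Z 0 \<omega>) ^ 3)"

lemma Z_cube: "integrable M (\<lambda>\<omega>. \<bar>Z t \<omega>\<bar> ^ 3)" "expectation (\<lambda>\<omega>. \<bar>Z t \<omega>\<bar> ^ 3) = cube_Z"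
  "expectation (\<lambda>\<omega>. (Z t \<omega>) ^ 3) = kappa"
  using cube_integrable integrable_transfer[of "\<lambda>x. \<bar>x\<bar> ^ 3" t 0] expectation_transfer[of "\<lambda>x. \<bar>x\<bar> ^ 3" t]
    expectation_transfer[of "\<lambda>x. x ^ 3" t]
  by (auto simp: cube_Z_def kappa_def)

lemma cube_Z_nonneg: "cube_Z \<ge> 0"
  by (simp add: cube_Z_def)

lemma cube_int_Z: "cube_int M (Z t)"
  using Z_cube by (simp add: cube_int_def)

lemma cube_int_wsum: "cube_int M (wsum a K)"
proof (cases "finite K")
  case True
  then show ?thesis
  proof induction
    case empty then show ?case by (simp add: wsum_def cube_int_def)
  next
    case (insert i K)
    then have "wsum a (insert i K) = (\<lambda>\<omega>. wsum a K \<omega> + a i * Z i \<omega>)"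
      by (auto simp: wsum_insert)
    then show ?case using insert by (auto intro!: cube_int_add cube_int_cmult cube_int_Z)
  qed
qed (simp add: wsum_def cube_int_def)

(* Induction on K: independence kills the linear term of the Taylor bound, so only a multiple of the
   square of the new coefficient is added. *)
lemma expectation_cube_wsum_le:
  assumes Q: "(\<Sum>j\<in>K. (a j)\<^sup>2) \<le> Q" and K: "finite K"
  shows "expectation (\<lambda>\<omega>. \<bar>wsum a K \<omega>\<bar> ^ 3) \<le>
    (3 * (1 + variance_Z * Q) * variance_Z + cube_Z * (1 + Q)) * (\<Sum>j\<in>K. (a j)\<^sup>2)"
  using K Q
proof induction
  case empty
  then show ?case by (simp add: wsum_def)
next
  case (insert i K)
  \<comment> \<open>The first summand of \<open>?D\<close> pays for the quadratic Taylor term, where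
    the first absolute moment of \<open>?S\<close> is at most \<open>1 + variance_Z * Q\<close>; the
    second pays for the cubic remainder.\<close>
  let ?D = "3 * (1 + variance_Z * Q) * variance_Z + cube_Z * (1 + Q)"
  let ?S = "wsum a K" and ?Y = "\<lambda>\<omega>. a i * Z i \<omega>"
  have Q: "(\<Sum>j\<in>K. (a j)\<^sup>2) + (a i)\<^sup>2 \<le> Q" using insert by (simp add: add.commute)
  have nn: "0 \<le> (\<Sum>j\<in>K. (a j)\<^sup>2)" by (rule sum_nonneg) simp
  have QK: "(\<Sum>j\<in>K. (a j)\<^sup>2) \<le> Q" and Qi: "(a i)\<^sup>2 \<le> Q"
    using Q nn by (smt (verit) zero_le_power2)+
  note ind = indep_wsum[OF insert(1,2), of a]
  note S2 = wsum_moments[OF insert(1), of a]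
  have S: "integrable M ?S" by (rule square_integrable_imp_integrable) (use S2 in auto)
  have S3: "integrable M (\<lambda>\<omega>. \<bar>?S \<omega>\<bar> ^ 3)" using cube_int_wsum by (simp add: cube_int_def)
  have Y: "integrable M ?Y" using Z_integrable by simp
  have SS: "integrable M (\<lambda>\<omega>. ?S \<omega> * \<bar>?S \<omega>\<bar>)"
    by (rule Bochner_Integration.integrable_bound[OF conjunct1[OF S2]]) (auto simp: abs_mult power2_eq_square)
  have Y2: "integrable M (\<lambda>\<omega>. (?Y \<omega>)\<^sup>2)" "expectation (\<lambda>\<omega>. (?Y \<omega>)\<^sup>2) = (a i)\<^sup>2 * variance_Z"
    using Z_sq[of i] by (auto simp: power_mult_distrib)
  have Y3: "integrable M (\<lambda>\<omega>. \<bar>?Y \<omega>\<bar> ^ 3)" "expectation (\<lambda>\<omega>. \<bar>?Y \<omega>\<bar> ^ 3) = \<bar>a i\<bar> ^ 3 * cube_Z"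
    using Z_cube[of i] by (auto simp: power_mult_distrib abs_mult)
  have i1: "indep_var borel (\<lambda>\<omega>. ?S \<omega> * \<bar>?S \<omega>\<bar>) borel ?Y"
    by (rule indep_var_compose[OF ind, of "\<lambda>x. x * \<bar>x\<bar>" borel "\<lambda>x. x" borel, unfolded comp_def]) auto
  have i2: "indep_var borel (\<lambda>\<omega>. \<bar>?S \<omega>\<bar>) borel (\<lambda>\<omega>. (?Y \<omega>)\<^sup>2)"
    by (rule indep_var_compose[OF ind, of "\<lambda>x. \<bar>x\<bar>" borel "\<lambda>x. x\<^sup>2" borel, unfolded comp_def]) auto
  note I1 = indep_var_integrable[OF i1 SS Y] and E1 = indep_var_lebesgue_integral[OF i1 SS Y]
  note I2 = indep_var_integrable[OF i2 integrable_abs[OF S] Y2(1)]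
    and E2 = indep_var_lebesgue_integral[OF i2 integrable_abs[OF S] Y2(1)]
  have ES: "expectation (\<lambda>\<omega>. \<bar>?S \<omega>\<bar>) \<le> 1 + variance_Z * Q"
  proof -
    have "\<bar>x\<bar> \<le> 1 + x\<^sup>2" for x :: real
      using sum_squares_bound[of 1 "\<bar>x\<bar>"] zero_le_power2[of x] by simp
    then have "expectation (\<lambda>\<omega>. \<bar>?S \<omega>\<bar>) \<le> expectation (\<lambda>\<omega>. 1 + (?S \<omega>)\<^sup>2)"
      using S S2 by (intro integral_mono) auto
    also have "\<dots> = 1 + variance_Z * (\<Sum>j\<in>K. (a j)\<^sup>2)" using S2 by (simp add: prob_space)
    also have "\<dots> \<le> 1 + variance_Z * Q" using QK variance_Z_nonneg by (simp add: mult_left_mono)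
    finally show ?thesis .
  qed
  \<comment> \<open>Trading the cube for a square keeps the bound linear in the sum of squares, so
    that it tends to zero along tails of a square-summable sequence.\<close>
  have ai: "\<bar>a i\<bar> ^ 3 \<le> (1 + Q) * (a i)\<^sup>2"
  proof -
    have "\<bar>a i\<bar> \<le> 1 + (a i)\<^sup>2"
      using sum_squares_bound[of 1 "\<bar>a i\<bar>"] zero_le_power2[of "a i"] by simp
    then have "\<bar>a i\<bar> \<le> 1 + Q" using Qi by simp
    then have "\<bar>a i\<bar> * (a i)\<^sup>2 \<le> (1 + Q) * (a i)\<^sup>2" by (intro mult_right_mono) auto
    then show ?thesis by (simp add: power3_eq_cube power2_eq_square abs_mult[symmetric])
  qed
  have "expectation (\<lambda>\<omega>. \<bar>wsum a (insert i K) \<omega>\<bar> ^ 3) \<le>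
    expectation (\<lambda>\<omega>. \<bar>?S \<omega>\<bar> ^ 3 + 3 * ((?S \<omega> * \<bar>?S \<omega>\<bar>) * ?Y \<omega>) + 3 * (\<bar>?S \<omega>\<bar> * (?Y \<omega>)\<^sup>2) + \<bar>?Y \<omega>\<bar> ^ 3)"
  proof (rule integral_mono)
    show "integrable M (\<lambda>\<omega>. \<bar>wsum a (insert i K) \<omega>\<bar> ^ 3)" using cube_int_wsum by (simp add: cube_int_def)
    show "\<bar>wsum a (insert i K) \<omega>\<bar> ^ 3 \<le>
      \<bar>?S \<omega>\<bar> ^ 3 + 3 * ((?S \<omega> * \<bar>?S \<omega>\<bar>) * ?Y \<omega>) + 3 * (\<bar>?S \<omega>\<bar> * (?Y \<omega>)\<^sup>2) + \<bar>?Y \<omega>\<bar> ^ 3" for \<omega>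
      using abs_add_cube_taylor[of "?S \<omega>" "?Y \<omega>"] by (simp add: wsum_insert insert(1,2) mult.assoc)
  qed (intro Bochner_Integration.integrable_add integrable_mult_right S3 I1 I2 Y3)
  also have "\<dots> = expectation (\<lambda>\<omega>. \<bar>?S \<omega>\<bar> ^ 3) + 3 * (expectation (\<lambda>\<omega>. ?S \<omega> * \<bar>?S \<omega>\<bar>) * expectation ?Y)
     + 3 * (expectation (\<lambda>\<omega>. \<bar>?S \<omega>\<bar>) * ((a i)\<^sup>2 * variance_Z)) + \<bar>a i\<bar> ^ 3 * cube_Z"
    using S3 I1 I2 Y3 E1 E2 Y2(2) by simp
  also have "expectation ?Y = 0" using Z_mean by simp
  also have "expectation (\<lambda>\<omega>. \<bar>?S \<omega>\<bar>) * ((a i)\<^sup>2 * variance_Z) \<le> (1 + variance_Z * Q) * ((a i)\<^sup>2 * variance_Z)"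
    using ES variance_Z_nonneg by (intro mult_right_mono) auto
  also have "\<bar>a i\<bar> ^ 3 * cube_Z \<le> ((1 + Q) * (a i)\<^sup>2) * cube_Z"
    using ai cube_Z_nonneg by (intro mult_right_mono)
  also have "expectation (\<lambda>\<omega>. \<bar>?S \<omega>\<bar> ^ 3) \<le> ?D * (\<Sum>j\<in>K. (a j)\<^sup>2)"
    by (rule insert.IH[OF QK])
  finally show ?case using insert(1,2) by (simp add: algebra_simps)
qed

text \<open>Unless all three indices agree, one of them differs from both others; the corresponding
  factor is independent of the product of the rest and centred.\<close>

lemma expectation_Z3:
  "expectation (\<lambda>\<omega>. Z i \<omega> * Z j \<omega> * Z l \<omega>) = (if i = j \<and> j = l then kappa else 0)"
proof -
  have off: "expectation (\<lambda>\<omega>. Z i \<omega> * Z j \<omega> * Z l \<omega>) = 0" if "l \<noteq> i" "l \<noteq> j" for i j l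
  proof -
    have "indep_var (PiM {i, j} (\<lambda>_. borel)) (\<lambda>\<omega>. restrict (\<lambda>k. Z k \<omega>) {i, j}) (PiM {l} (\<lambda>_. borel)) (\<lambda>\<omega>. restrict (\<lambda>k. Z k \<omega>) {l})"
      using that by (intro indep_var_restrict[OF indep]) auto
    then have "indep_var borel ((\<lambda>z. z i * z j) \<circ> (\<lambda>\<omega>. restrict (\<lambda>k. Z k \<omega>) {i, j})) borel
       ((\<lambda>z. z l) \<circ> (\<lambda>\<omega>. restrict (\<lambda>k. Z k \<omega>) {l}))"
      by (rule indep_var_compose) auto
    then have ind: "indep_var borel (\<lambda>\<omega>. Z i \<omega> * Z j \<omega>) borel (Z l)"
      by (simp add: comp_def)
    have "integrable M (\<lambda>\<omega>. Z i \<omega> * Z j \<omega> * 1)"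
      by (intro cube_int_mult3 cube_int_Z) (simp add: cube_int_def)
    then have "integrable M (\<lambda>\<omega>. Z i \<omega> * Z j \<omega>)" by simp
    from indep_var_lebesgue_integral[OF ind this Z_integrable] show ?thesis using Z_mean by simp
  qed
  consider "i = j" "j = l" | "l \<noteq> i" "l \<noteq> j" | "j \<noteq> i" "j \<noteq> l" | "i \<noteq> j" "i \<noteq> l" by blast
  then show ?thesis
  proof cases
    case 1
    then show ?thesis using Z_cube(3)[of i] by (simp add: power3_eq_cube)
  next
    case 2
    then show ?thesis using off[of l i j] by auto
  next
    case 3
    then show ?thesis using off[of j i l] by (auto simp: mult_ac)
  next
    case 4
    then show ?thesis using off[of i j l] by (auto simp: mult_ac)
  qed
qed

lemma expectation_wsum3:
  assumes "finite K"
  shows "expectation (\<lambda>\<omega>. wsum a K \<omega> * wsum b K \<omega> * wsum d K \<omega>) = kappa * (\<Sum>j\<in>K. a j * b j * d j)"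
proof -
  have i: "integrable M (\<lambda>\<omega>. Z i \<omega> * Z j \<omega> * Z l \<omega>)" for i j l
    by (intro cube_int_mult3 cube_int_Z)
  have "expectation (\<lambda>\<omega>. wsum a K \<omega> * wsum b K \<omega> * wsum d K \<omega>) =
      expectation (\<lambda>\<omega>. \<Sum>i\<in>K. \<Sum>j\<in>K. \<Sum>l\<in>K. (a i * b j * d l) * (Z i \<omega> * Z j \<omega> * Z l \<omega>))"
    by (simp only: wsum_def sum_mult3) (simp only: mult_ac)
  also have "\<dots> = (\<Sum>i\<in>K. \<Sum>j\<in>K. \<Sum>l\<in>K. (a i * b j * d l) * expectation (\<lambda>\<omega>. Z i \<omega> * Z j \<omega> * Z l \<omega>))"
    using i by (simp add: Bochner_Integration.integral_sum)
  also have "\<dots> = (\<Sum>i\<in>K. \<Sum>j\<in>K. \<Sum>l\<in>K. if l = j then (if j = i then a i * b j * d l * kappa else 0) else 0)"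
    by (intro sum.cong) (auto simp: expectation_Z3)
  also have "\<dots> = (\<Sum>i\<in>K. \<Sum>j\<in>K. if j = i then a i * b j * d j * kappa else 0)"
    using assms by (intro sum.cong refl) (simp add: sum.delta)
  also have "\<dots> = (\<Sum>i\<in>K. a i * b i * d i * kappa)"
    using assms by (intro sum.cong refl) (simp add: sum.delta)
  finally show ?thesis by (simp add: sum_distrib_left mult_ac)
qed

text \<open>The trailing factor 1 puts second moments into the shape of a threefold product, so that
  one limit theorem serves covariances and cumulants alike.\<close>

lemma expectation_wsum2:
  assumes "finite K"
  shows "expectation (\<lambda>\<omega>. wsum a K \<omega> * wsum b K \<omega> * 1) = variance_Z * (\<Sum>j\<in>K. a j * b j)"
proof -
  have "integrable M (\<lambda>\<omega>. Z i \<omega> * Z j \<omega> * 1)" for i j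
    by (intro cube_int_mult3 cube_int_Z) (simp add: cube_int_def)
  then have i: "integrable M (\<lambda>\<omega>. Z i \<omega> * Z j \<omega>)" for i j by simp
  have "expectation (\<lambda>\<omega>. wsum a K \<omega> * wsum b K \<omega> * 1) =
      expectation (\<lambda>\<omega>. \<Sum>i\<in>K. \<Sum>j\<in>K. (a i * b j) * (Z i \<omega> * Z j \<omega>))"
    by (simp only: wsum_def mult_1_right sum_product) (simp only: mult_ac)
  also have "\<dots> = (\<Sum>i\<in>K. \<Sum>j\<in>K. (a i * b j) * expectation (\<lambda>\<omega>. Z i \<omega> * Z j \<omega>))"
    using i by (simp add: Bochner_Integration.integral_sum)
  also have "\<dots> = (\<Sum>i\<in>K. \<Sum>j\<in>K. if j = i then a i * b j * variance_Z else 0)"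
    by (intro sum.cong) (auto simp: expectation_Z2)
  also have "\<dots> = (\<Sum>i\<in>K. a i * b i * variance_Z)"
    using assms by (intro sum.cong refl) (simp add: sum.delta)
  finally show ?thesis by (simp add: sum_distrib_left mult_ac)
qed

end

lemma sum_reindex_minus:
  fixes a :: int
  shows "sum h ((\<lambda>k. a - k) ` K) = (\<Sum>k\<in>K. h (a - k))"
  by (subst sum.reindex) (auto simp: inj_on_def)

lemma image_minus_int_interval: "(\<lambda>k. a - k) ` {b - int n..b + int n} = {a - b - int n..a - b + int n}"
  by (simp add: algebra_simps)

locale moving_average_cube = moving_average + iid_cube
begin

definition c_total :: real where "c_total = infsum (\<lambda>k. (c k)\<^sup>2) UNIV"

text \<open>Indexed by lags, whereas \<open>wsum\<close> is indexed by the times of the innovations.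
  Lags suit the approximation of a single \<open>X t\<close> by windows of any position; times suit
  joint moments, where sums for different \<open>t\<close> must share one index set.\<close>

definition psum :: "int set \<Rightarrow> int \<Rightarrow> 'a \<Rightarrow> real" where
  "psum K t \<omega> = (\<Sum>k\<in>K. c k * Z (t - k) \<omega>)"

lemma psum_eq_wsum: "psum K t = wsum (\<lambda>j. c (t - j)) ((\<lambda>k. t - k) ` K)"
  unfolding psum_def[abs_def] wsum_def[abs_def] sum_reindex_minus by simp

lemma sum_c_le_total: "finite K \<Longrightarrow> (\<Sum>k\<in>K. (c k)\<^sup>2) \<le> c_total"
  unfolding c_total_def by (rule finite_sum_le_infsum[OF c_summable]) auto

lemma c_tail_tendsto: "(\<lambda>n. c_total - (\<Sum>k\<in>{a - int n..a + int n}. (c k)\<^sup>2)) \<longlonglongrightarrow> 0"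
proof -
  have "(\<lambda>n. \<Sum>k\<in>{a - int n..a + int n}. (c k)\<^sup>2) \<longlonglongrightarrow> c_total"
    unfolding c_total_def using filterlim_compose[OF infsum_tendsto[OF c_summable] filterlim_int_intervals] .
  from tendsto_diff[OF tendsto_const this, of c_total] show ?thesis by simp
qed

text \<open>The constant of the third-moment bound with \<open>Q\<close> set to the total sum of
  squares, so that it is uniform over all finite windows.\<close>

definition "cube_const = 3 * (1 + variance_Z * c_total) * variance_Z + cube_Z * (1 + c_total)"

lemma cube_const_nonneg: "cube_const \<ge> 0"
  using sum_c_le_total[of "{}"] variance_Z_nonneg cube_Z_nonneg by (simp add: cube_const_def)

lemma cube_int_psum: "cube_int M (psum K t)"
  unfolding psum_eq_wsum by (rule cube_int_wsum)

lemma expectation_cube_psum_le: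
  assumes "finite K"
  shows "expectation (\<lambda>\<omega>. \<bar>psum K t \<omega>\<bar> ^ 3) \<le> cube_const * (\<Sum>k\<in>K. (c k)\<^sup>2)"
  using expectation_cube_wsum_le[of "\<lambda>j. c (t - j)" "(\<lambda>k. t - k) ` K" c_total] sum_c_le_total[OF assms] assms
  by (simp add: psum_eq_wsum sum_reindex_minus cube_const_def)

text \<open>For a symmetric window containing \<open>K\<close>, the difference of the two partial
  sums is again a partial sum, over the lags outside \<open>K\<close>; its third moment is
  controlled by the squares that \<open>K\<close> leaves out. Fatou lets the window grow.\<close>

lemma X_approx:
  assumes K: "finite K"
  shows "cube_int M (\<lambda>\<omega>. X t \<omega> - psum K t \<omega>)"
    and "expectation (\<lambda>\<omega>. \<bar>X t \<omega> - psum K t \<omega>\<bar> ^ 3) \<le> cube_const * (c_total - (\<Sum>k\<in>K. (c k)\<^sup>2))"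
proof -
  let ?I = "\<lambda>m. {- int m..int m}"
  have [measurable]: "psum K t \<in> borel_measurable M" for K
    using cube_int_psum by (rule cube_int_measurable)
  have ev: "eventually (\<lambda>m. expectation (\<lambda>\<omega>. \<bar>psum (?I m) t \<omega> - psum K t \<omega>\<bar> ^ 3) \<le> cube_const * (c_total - (\<Sum>k\<in>K. (c k)\<^sup>2))) sequentially"
  proof -
    have "eventually (\<lambda>m. finite (?I m) \<and> K \<subseteq> ?I m \<and> ?I m \<subseteq> UNIV) sequentially"
      using filterlim_int_intervals[of 0] K unfolding filterlim_finite_subsets_at_top by simp
    then show ?thesis
    proof eventually_elim
      case (elim m)
      have "psum (?I m) t \<omega> - psum K t \<omega> = psum (?I m - K) t \<omega>" for \<omega>
        using elim by (simp add: psum_def sum_diff)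
      then have "expectation (\<lambda>\<omega>. \<bar>psum (?I m) t \<omega> - psum K t \<omega>\<bar> ^ 3) \<le> cube_const * (\<Sum>k\<in>?I m - K. (c k)\<^sup>2)"
        using expectation_cube_psum_le[of "?I m - K" t] by simp
      also have "(\<Sum>k\<in>?I m - K. (c k)\<^sup>2) = (\<Sum>k\<in>?I m. (c k)\<^sup>2) - (\<Sum>k\<in>K. (c k)\<^sup>2)"
        using elim by (simp add: sum_diff)
      also have "cube_const * \<dots> \<le> cube_const * (c_total - (\<Sum>k\<in>K. (c k)\<^sup>2))"
        using cube_const_nonneg sum_c_le_total by (intro mult_left_mono diff_right_mono) auto
      finally show ?case .
    qed
  qed
  have int: "integrable M (\<lambda>\<omega>. \<bar>psum (?I m) t \<omega> - psum K t \<omega>\<bar> ^ 3)" for m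
    using cube_int_diff[OF cube_int_psum cube_int_psum] by (simp add: cube_int_def)
  have lim: "AE \<omega> in M. (\<lambda>m. \<bar>psum (?I m) t \<omega> - psum K t \<omega>\<bar> ^ 3) \<longlonglongrightarrow> \<bar>X t \<omega> - psum K t \<omega>\<bar> ^ 3"
    using X_lim[of t] by eventually_elim (intro tendsto_intros, simp add: psum_def)
  note F = Fatou_integral_le[OF int _ _ lim ev]
  have "integrable M (\<lambda>\<omega>. \<bar>X t \<omega> - psum K t \<omega>\<bar> ^ 3)" by (rule F) auto
  moreover have "(\<lambda>\<omega>. X t \<omega> - psum K t \<omega>) \<in> borel_measurable M" by measurable
  ultimately show "cube_int M (\<lambda>\<omega>. X t \<omega> - psum K t \<omega>)" by (simp add: cube_int_def)
  show "expectation (\<lambda>\<omega>. \<bar>X t \<omega> - psum K t \<omega>\<bar> ^ 3) \<le> cube_const * (c_total - (\<Sum>k\<in>K. (c k)\<^sup>2))"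
    by (rule F) auto
qed

lemma cube_int_X: "cube_int M (X t)"
  using X_approx(1)[of "{}" t] by (simp add: psum_def)

lemma X_approx_tendsto:
  "(\<lambda>n. expectation (\<lambda>\<omega>. \<bar>psum {a - int n..a + int n} t \<omega> - X t \<omega>\<bar> ^ 3)) \<longlonglongrightarrow> 0"
proof (rule tendsto_sandwich[OF _ _ tendsto_const])
  show "(\<lambda>n. cube_const * (c_total - (\<Sum>k\<in>{a - int n..a + int n}. (c k)\<^sup>2))) \<longlonglongrightarrow> 0"
    using tendsto_mult[OF tendsto_const[of cube_const] c_tail_tendsto[of a]] by simp
  show "eventually (\<lambda>n. expectation (\<lambda>\<omega>. \<bar>psum {a - int n..a + int n} t \<omega> - X t \<omega>\<bar> ^ 3) \<le>
      cube_const * (c_total - (\<Sum>k\<in>{a - int n..a + int n}. (c k)\<^sup>2))) sequentially"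
    using X_approx(2)[of "{a - int n..a + int n}" t for n] by (simp add: abs_minus_commute)
qed simp

text \<open>Lags centred at \<open>t\<close> correspond to innovation times centred at 0, so all
  \<open>X t\<close> are approximated over the same set of times.\<close>

lemma wsum_tendsto_X:
  "(\<lambda>n. expectation (\<lambda>\<omega>. \<bar>wsum (\<lambda>j. c (t - j)) {- int n..int n} \<omega> - X t \<omega>\<bar> ^ 3)) \<longlonglongrightarrow> 0"
  using X_approx_tendsto[of t t] image_minus_int_interval[of t t]
  by (simp add: psum_eq_wsum)

lemma expectation_X: "expectation (X t) = 0"
proof -
  have one: "cube_int M (\<lambda>_. 1)" by (simp add: cube_int_def)
  have "(\<lambda>n. expectation (\<lambda>\<omega>. wsum (\<lambda>j. c (t - j)) {- int n..int n} \<omega> * 1 * 1)) \<longlonglongrightarrow> expectation (\<lambda>\<omega>. X t \<omega> * 1 * 1)"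
    by (intro tendsto_integral_mult3 cube_int_wsum cube_int_X wsum_tendsto_X one) simp_all
  moreover have "expectation (\<lambda>\<omega>. wsum (\<lambda>j. c (t - j)) {- int n..int n} \<omega> * 1 * 1) = 0" for n
    using Z_integrable Z_mean by (simp add: wsum_def)
  ultimately show ?thesis by (simp add: LIMSEQ_const_iff)
qed

lemma cov2_tendsto:
  "(\<lambda>n. variance_Z * (\<Sum>j\<in>{- int n..int n}. c j * c (j + t))) \<longlonglongrightarrow> cov2 M (X 0) (X t)"
proof -
  have one: "cube_int M (\<lambda>_. 1)" by (simp add: cube_int_def)
  have "(\<lambda>n. expectation (\<lambda>\<omega>. wsum (\<lambda>j. c (0 - j)) {- int n..int n} \<omega> * wsum (\<lambda>j. c (t - j)) {- int n..int n} \<omega> * 1))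
      \<longlonglongrightarrow> expectation (\<lambda>\<omega>. X 0 \<omega> * X t \<omega> * 1)"
    by (intro tendsto_integral_mult3 cube_int_wsum cube_int_X wsum_tendsto_X one) simp_all
  then have "(\<lambda>n. variance_Z * (\<Sum>j\<in>{- int n..int n}. c (- j) * c (- j + t))) \<longlonglongrightarrow> expectation (\<lambda>\<omega>. X 0 \<omega> * X t \<omega>)"
    by (subst (asm) expectation_wsum2) simp_all
  then show ?thesis
    using sum_symm_uminus[of "\<lambda>j. c j * c (j + t)"] by (simp add: cov2_def expectation_X)
qed

lemma cum3_tendsto:
  "(\<lambda>n. kappa * (\<Sum>j\<in>{- int n..int n}. c j * c (j + t) * c (j + s))) \<longlonglongrightarrow> cum3 M (X 0) (X t) (X s)"
proof -
  have "(\<lambda>n. expectation (\<lambda>\<omega>. wsum (\<lambda>j. c (0 - j)) {- int n..int n} \<omega> * wsum (\<lambda>j. c (t - j)) {- int n..int n} \<omega> *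
       wsum (\<lambda>j. c (s - j)) {- int n..int n} \<omega>)) \<longlonglongrightarrow> expectation (\<lambda>\<omega>. X 0 \<omega> * X t \<omega> * X s \<omega>)"
    by (intro tendsto_integral_mult3 cube_int_wsum cube_int_X wsum_tendsto_X)
  then have "(\<lambda>n. kappa * (\<Sum>j\<in>{- int n..int n}. c (- j) * c (- j + t) * c (- j + s))) \<longlonglongrightarrow> expectation (\<lambda>\<omega>. X 0 \<omega> * X t \<omega> * X s \<omega>)"
    by (subst (asm) expectation_wsum3) simp_all
  then show ?thesis
    using sum_symm_uminus[of "\<lambda>j. c j * c (j + t) * c (j + s)"] by (simp add: cum3_def expectation_X)
qed

section \<open>The moving average as a functional of the innovations, and time reversal\<close>

text \<open>A fixed measurable functional on sequences: equality in law of two innovation sequences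
  then transfers to the processes built from them. Its value where the series diverges is arbitrary
  and concerns a null set under \<open>law_Z\<close>.\<close>

definition lin_map :: "int \<Rightarrow> (int \<Rightarrow> real) \<Rightarrow> real" where
  "lin_map t z = lim (\<lambda>n. \<Sum>k\<in>{- int n..int n}. c k * z (t - k))"

lemma lin_map_measurable [measurable]: "lin_map t \<in> borel_measurable (PiM UNIV (\<lambda>_. borel))"
  unfolding lin_map_def[abs_def] by (rule borel_measurable_lim_metric) measurable

lemma X_eq_lin_map: "AE \<omega> in M. X t \<omega> = lin_map t (\<lambda>j. Z j \<omega>)"
  using X_lim[of t] by eventually_elim (simp add: lin_map_def limI)

abbreviation "law_Z \<equiv> PiM UNIV (\<lambda>_::int. distr M borel (Z 0))"

lemma distr_Z: "distr M (PiM UNIV (\<lambda>_. borel)) (\<lambda>\<omega> j. Z j \<omega>) = law_Z"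
proof -
  have "distr M (PiM UNIV (\<lambda>_. borel)) (\<lambda>\<omega>. \<lambda>j\<in>UNIV. Z j \<omega>) = PiM UNIV (\<lambda>j. distr M borel (Z j))"
    using indep_vars_iff_distr_eq_PiM[where I = UNIV and M' = "\<lambda>_. borel" and X = Z] indep by simp
  moreover have "(\<lambda>j. distr M borel (Z j)) = (\<lambda>_. distr M borel (Z 0))"
    by (intro ext ident)
  ultimately show ?thesis by (simp add: restrict_def)
qed

lemma distr_Z_reflected: "distr M (PiM UNIV (\<lambda>_. borel)) (\<lambda>\<omega> j. Z (a - j) \<omega>) = law_Z"
proof -
  have [measurable]: "(\<lambda>z j. z (a - j)) \<in> measurable (PiM UNIV (\<lambda>_. borel)) (PiM UNIV (\<lambda>_::int. borel :: real measure))"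
    by (rule measurable_PiM_single') (auto simp: space_PiM)
  have [measurable]: "(\<lambda>\<omega> j. Z j \<omega>) \<in> measurable M (PiM UNIV (\<lambda>_. borel))"
    by (rule measurable_PiM_single') (auto simp: space_PiM)
  have "distr M (PiM UNIV (\<lambda>_. borel)) (\<lambda>\<omega> j. Z (a - j) \<omega>) =
     distr (distr M (PiM UNIV (\<lambda>_. borel)) (\<lambda>\<omega> j. Z j \<omega>)) (PiM UNIV (\<lambda>_. borel)) (\<lambda>z j. z (a - j))"
    by (subst distr_distr) (simp_all add: comp_def)
  also have "\<dots> = distr law_Z (PiM UNIV (\<lambda>_. borel)) (\<lambda>z j. z (a - j))" by (simp add: distr_Z)
  also have "\<dots> = distr law_Z law_Z (\<lambda>z. \<lambda>j\<in>UNIV. z (a - j))"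
    by (rule distr_cong) (auto intro!: sets_PiM_cong)
  also have "\<dots> = law_Z"
    by (rule distr_PiM_reindex) (auto simp: inj_on_def intro!: prob_space_distr)
  finally show ?thesis .
qed

text \<open>Formally the functional at the reflected innovations is the sum of
  \<open>c k * Z (r - m + k)\<close>, and the substitution of \<open>m - k\<close> for
  \<open>k\<close> turns it into the series of \<open>X r\<close>. That substitution also moves the
  windows to centre \<open>m\<close>, where almost sure convergence to \<open>X r\<close> is not
  given. Convergence therefore comes from equality in law, and the limit is identified in third
  mean.\<close>

lemma X_eq_lin_map_reflected:
  assumes refl: "\<And>j. c (m - j) = c j"
  shows "AE \<omega> in M. X r \<omega> = lin_map t (\<lambda>j. Z (r + t - m - j) \<omega>)"
proof -
  let ?Z' = "\<lambda>\<omega> j. Z (r + t - m - j) \<omega>"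
  let ?P = "PiM UNIV (\<lambda>_::int. borel :: real measure)"
  let ?S = "\<lambda>n z. \<Sum>k\<in>{- int n..int n}. c k * z (t - k)"
  have mZ: "(\<lambda>\<omega> j. Z j \<omega>) \<in> measurable M ?P" and mZ' [measurable]: "?Z' \<in> measurable M ?P"
    by (rule measurable_PiM_single'; auto simp: space_PiM)+
  have conv: "{z \<in> space ?P. convergent (\<lambda>n. ?S n z)} \<in> sets ?P"
  proof -
    have "{z \<in> space ?P. Cauchy (\<lambda>n. ?S n z)} \<in> sets ?P"
      by (rule sets_Collect_Cauchy) measurable
    then show ?thesis by (simp add: Cauchy_convergent_iff)
  qed
  have "AE \<omega> in M. convergent (\<lambda>n. ?S n (\<lambda>j. Z j \<omega>))"
    using X_lim[of t] by eventually_elim (auto simp: convergent_def)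
  then have "AE z in distr M ?P (\<lambda>\<omega> j. Z j \<omega>). convergent (\<lambda>n. ?S n z)"
    using AE_distr_iff[OF mZ conv] by simp
  \<comment> \<open>Convergence of the series is an event in sequence space, so its probability
    depends only on the law of the sequence.\<close>
  then have "AE z in distr M ?P ?Z'. convergent (\<lambda>n. ?S n z)"
    by (simp only: distr_Z distr_Z_reflected)
  then have "AE \<omega> in M. convergent (\<lambda>n. ?S n (?Z' \<omega>))"
    using AE_distr_iff[OF mZ' conv] by simp
  then have lim: "AE \<omega> in M. (\<lambda>n. ?S n (?Z' \<omega>)) \<longlonglongrightarrow> lin_map t (?Z' \<omega>)"
    by eventually_elim (simp add: lin_map_def convergent_LIMSEQ_iff)
  have S: "?S n (?Z' \<omega>) = psum {m - int n..m + int n} r \<omega>" for n \<omega>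
  proof -
    have "psum {m - int n..m + int n} r \<omega> = psum ((\<lambda>k. m - k) ` {- int n..int n}) r \<omega>"
      using image_minus_int_interval[of m 0 n] by simp
    also have "\<dots> = (\<Sum>k\<in>{- int n..int n}. c (m - k) * Z (r - (m - k)) \<omega>)"
      unfolding psum_def sum_reindex_minus ..
    also have "\<dots> = ?S n (?Z' \<omega>)"
    proof (rule sum.cong)
      fix k
      have "r - (m - k) = r + t - m - (t - k)" by simp
      then show "c (m - k) * Z (r - (m - k)) \<omega> = c k * Z (r + t - m - (t - k)) \<omega>"
        by (simp only: assms)
    qed simp
    finally show ?thesis ..
  qed
  let ?D = "\<lambda>n \<omega>. \<bar>psum {m - int n..m + int n} r \<omega> - X r \<omega>\<bar> ^ 3"
  have mL [measurable]: "(\<lambda>\<omega>. lin_map t (?Z' \<omega>)) \<in> borel_measurable M" by measurable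
  have int: "integrable M (?D n)" for n
    using cube_int_diff[OF cube_int_psum cube_int_X] by (simp add: cube_int_def)
  have l: "AE \<omega> in M. (\<lambda>n. ?D n \<omega>) \<longlonglongrightarrow> \<bar>lin_map t (?Z' \<omega>) - X r \<omega>\<bar> ^ 3"
    using lim unfolding S by eventually_elim (intro tendsto_intros)
  \<comment> \<open>The third moments of the approximation errors tend to zero, so Fatou bounds that
    of the limit by every positive \<open>e\<close>.\<close>
  have le: "integrable M (\<lambda>\<omega>. \<bar>lin_map t (?Z' \<omega>) - X r \<omega>\<bar> ^ 3) \<and> expectation (\<lambda>\<omega>. \<bar>lin_map t (?Z' \<omega>) - X r \<omega>\<bar> ^ 3) \<le> 0 + e" if "e > 0" for e
  proof -
    have "eventually (\<lambda>n. expectation (?D n) < e) sequentially"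
      using order_tendstoD(2)[OF X_approx_tendsto that] .
    then have "eventually (\<lambda>n. expectation (?D n) \<le> 0 + e) sequentially"
      by eventually_elim simp
    from Fatou_integral_le[OF int _ _ l this] show ?thesis by simp
  qed
  have "expectation (\<lambda>\<omega>. \<bar>lin_map t (?Z' \<omega>) - X r \<omega>\<bar> ^ 3) \<le> 0"
    by (rule field_le_epsilon) (use le in blast)
  then have "expectation (\<lambda>\<omega>. \<bar>lin_map t (?Z' \<omega>) - X r \<omega>\<bar> ^ 3) = 0"
    by (intro antisym integral_nonneg_AE) auto
  then have "AE \<omega> in M. \<bar>lin_map t (?Z' \<omega>) - X r \<omega>\<bar> ^ 3 = 0"
    using le[of 1] by (subst (asm) integral_nonneg_eq_0_iff_AE) auto
  then show ?thesis by eventually_elim simp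
qed

theorem reversible_of_reflection:
  assumes refl: "\<And>j. c (m - j) = c j"
  shows "reversible M X"
  unfolding reversible_def
proof (intro allI)
  fix k :: nat and t :: int
  let ?N = "PiM {..k} (\<lambda>_. borel :: real measure)"
  let ?P = "PiM UNIV (\<lambda>_::int. borel :: real measure)"
  \<comment> \<open>The \<open>i\<close>-th coordinate needs \<open>t + int i\<close> on the side of
    the functional and \<open>t + int k - int i\<close> on the side of \<open>X\<close>. Their sum
    is free of \<open>i\<close>, so one reflected sequence serves all coordinates
    simultaneously.\<close>
  let ?Z' = "\<lambda>\<omega> j. Z (2 * t + int k - m - j) \<omega>"
  define \<Psi> where "\<Psi> z = (\<lambda>i\<in>{..k}. lin_map (t + int i) z)" for z
  have mP [measurable]: "\<Psi> \<in> measurable ?P ?N"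
    unfolding \<Psi>_def by measurable
  have mZ [measurable]: "(\<lambda>\<omega> j. Z j \<omega>) \<in> measurable M ?P" and mZ' [measurable]: "?Z' \<in> measurable M ?P"
    by (rule measurable_PiM_single'; auto simp: space_PiM)+
  have "distr M ?N (\<lambda>\<omega>. \<lambda>i\<in>{..k}. X (t + int i) \<omega>) = distr M ?N (\<lambda>\<omega>. \<Psi> (\<lambda>j. Z j \<omega>))"
  proof (rule distr_cong_AE)
    have "AE \<omega> in M. \<forall>i::nat. X (t + int i) \<omega> = lin_map (t + int i) (\<lambda>j. Z j \<omega>)"
      unfolding AE_all_countable using X_eq_lin_map by blast
    then show "AE \<omega> in M. (\<lambda>i\<in>{..k}. X (t + int i) \<omega>) = \<Psi> (\<lambda>j. Z j \<omega>)"
      by eventually_elim (auto simp: \<Psi>_def)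
  qed (auto, measurable)
  also have "\<dots> = distr (distr M ?P (\<lambda>\<omega> j. Z j \<omega>)) ?N \<Psi>"
    by (subst distr_distr) (auto simp: comp_def)
  also have "\<dots> = distr (distr M ?P ?Z') ?N \<Psi>"
    by (simp only: distr_Z distr_Z_reflected)
  also have "\<dots> = distr M ?N (\<lambda>\<omega>. \<Psi> (?Z' \<omega>))"
    by (subst distr_distr) (auto simp: comp_def)
  also have "\<dots> = distr M ?N (\<lambda>\<omega>. \<lambda>i\<in>{..k}. X (t + int k - int i) \<omega>)"
  proof (rule distr_cong_AE)
    have "AE \<omega> in M. X (t + int k - int i) \<omega> = lin_map (t + int i) (?Z' \<omega>)" for i :: nat
      using X_eq_lin_map_reflected[OF refl, of "t + int k - int i" "t + int i"]
      by (simp add: algebra_simps)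
    then have "AE \<omega> in M. \<forall>i::nat. X (t + int k - int i) \<omega> = lin_map (t + int i) (?Z' \<omega>)"
      unfolding AE_all_countable by blast
    then show "AE \<omega> in M. \<Psi> (?Z' \<omega>) = (\<lambda>i\<in>{..k}. X (t + int k - int i) \<omega>)"
      by eventually_elim (auto simp: \<Psi>_def)
  qed (auto, measurable)
  finally show "distr M ?N (\<lambda>\<omega>. \<lambda>i\<in>{..k}. X (t + int i) \<omega>) =
     distr M ?N (\<lambda>\<omega>. \<lambda>i\<in>{..k}. X (t + int k - int i) \<omega>)" .
qed

end

section \<open>Spectral density and bispectrum\<close>

text \<open>Restates uniqueness for Lebesgue measure, in which spectral density and bispectrum are
  expressed; the factor \<open>2*pi\<close> of \<open>circ\<close> does not affect
  vanishing.\<close>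

lemma supported_AE_0:
  fixes g :: "real \<Rightarrow> complex"
  assumes int: "integrable lborel g" and supp: "\<And>x. x \<notin> {0..<2*pi} \<Longrightarrow> g x = 0"
    and zero: "\<And>t. (\<integral>x. ech t x * g x \<partial>lborel) = 0"
  shows "AE x in lborel. g x = 0"
proof -
  have [measurable]: "g \<in> borel_measurable borel" using int by simp
  have ind: "indicator {0..<2*pi} x *\<^sub>R (h x * g x) = h x * g x" for x and h :: "real \<Rightarrow> complex"
    using supp[of x] by (cases "x \<in> {0..<2*pi}") auto
  have "vanishing_fc g"
    unfolding vanishing_fc_def
  proof (intro conjI allI)
    show "integrable circ g"
      using int ind[of _ "\<lambda>_. 1"] by (simp add: integrable_circ_iff set_integrable_def)
    show "(\<integral>x. ech t x * g x \<partial>circ) = 0" for t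
      using zero[of t] by (simp add: integral_circ set_lebesgue_integral_def ind)
  qed
  then have "AE x in circ. g x = 0" by (rule vanishing_fc_AE_0)
  then have "AE x in lborel. x \<in> {0..<2*pi} \<longrightarrow> g x = 0" by (simp only: AE_circ_iff)
  then show ?thesis by eventually_elim (use supp in blast)
qed

lemma exp_eq_ech: "exp (\<i> * (of_int t * complex_of_real x)) = ech t x"
  by (simp add: ech_def cis_conv_exp)

lemma exp_eq_ech2:
  "exp (\<i> * (of_int t * complex_of_real x + of_int s * complex_of_real y)) = ech t x * ech s y"
  by (simp add: distrib_left exp_add exp_eq_ech)

text \<open>Fubini reduces to one variable twice: for fixed \<open>s\<close> the partial coefficient
  in \<open>y\<close> is a function of \<open>x\<close> with vanishing coefficients, hence zero
  almost everywhere; then almost every slice has vanishing coefficients itself.\<close>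

lemma supported_AE_0_2d:
  fixes h :: "real \<times> real \<Rightarrow> complex"
  assumes int: "integrable lborel h" and supp: "\<And>p. p \<notin> {0..<2*pi} \<times> {0..<2*pi} \<Longrightarrow> h p = 0"
    and zero: "\<And>t s. (\<integral>p. ech t (fst p) * ech s (snd p) * h p \<partial>lborel) = 0"
  shows "AE p in lborel. h p = 0"
proof -
  have [measurable]: "h \<in> borel_measurable (borel \<Otimes>\<^sub>M borel)" using int by (simp add: borel_prod)
  have inth: "integrable (lborel \<Otimes>\<^sub>M lborel) h" using int by (simp add: lborel_prod)
  have int2: "integrable (lborel \<Otimes>\<^sub>M lborel) (\<lambda>p. ech t (fst p) * ech s (snd p) * h p)" for t s
    by (rule integrable_bounded_mult[where C = 1, OF inth]) (simp_all add: norm_mult)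
  have inner: "AE x in lborel. (\<integral>y. ech s y * h (x, y) \<partial>lborel) = 0" for s
  proof (rule supported_AE_0)
    have i: "integrable (lborel \<Otimes>\<^sub>M lborel) (\<lambda>p. ech s (snd p) * h p)"
      using int2[of 0 s] by simp
    from lborel_pair.integrable_fst'[OF i]
    show "integrable lborel (\<lambda>x. \<integral>y. ech s y * h (x, y) \<partial>lborel)" by simp
    show "(\<integral>y. ech s y * h (x, y) \<partial>lborel) = 0" if "x \<notin> {0..<2*pi}" for x
    proof -
      have "h (x, y) = 0" for y by (rule supp) (use that in auto)
      then show ?thesis by simp
    qed
    fix t
    have "(\<integral>x. ech t x * (\<integral>y. ech s y * h (x, y) \<partial>lborel) \<partial>lborel) =
        (\<integral>x. (\<integral>y. ech t (fst (x, y)) * ech s (snd (x, y)) * h (x, y) \<partial>lborel) \<partial>lborel)"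
      by (simp add: mult.assoc)
    also have "\<dots> = (\<integral>p. ech t (fst p) * ech s (snd p) * h p \<partial>(lborel \<Otimes>\<^sub>M lborel))"
      by (rule lborel_pair.integral_fst'[OF int2])
    also have "\<dots> = 0" using zero by (simp add: lborel_prod)
    finally show "(\<integral>x. ech t x * (\<integral>y. ech s y * h (x, y) \<partial>lborel) \<partial>lborel) = 0" .
  qed
  \<comment> \<open>The exceptional null sets, one for each integer \<open>s\<close>, are merged by
    countability.\<close>
  have "AE x in lborel. \<forall>s. (\<integral>y. ech s y * h (x, y) \<partial>lborel) = 0"
    unfolding AE_all_countable using inner by blast
  with lborel_pair.AE_integrable_fst'[OF inth]
  have "AE x in lborel. AE y in lborel. h (x, y) = 0"
  proof eventually_elim
    case (elim x)
    show ?case by (rule supported_AE_0) (use elim supp in auto)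
  qed
  moreover have "{p \<in> space (lborel \<Otimes>\<^sub>M lborel). h p = 0} \<in> sets (lborel \<Otimes>\<^sub>M lborel)"
    by measurable
  ultimately have "AE p in lborel \<Otimes>\<^sub>M lborel. h p = 0"
    by (intro lborel_pair.AE_pair_measure)
  then show ?thesis by (simp only: lborel_prod)
qed

section \<open>What the spectral density and the bispectrum say about C and kappa\<close>

context moving_average_cube
begin

text \<open>On the interval, \<open>f\<close> and a multiple of the squared modulus of
  \<open>C\<close> have the same Fourier coefficients, namely the autocovariances up to a factor.
  They agree almost everywhere, so \<open>C\<close> cannot vanish where \<open>f\<close> is
  positive.\<close>

lemma transfer_function_nonzero:
  assumes C: "fourier_series (\<lambda>k. of_real (c k)) C"
    and f: "is_spectral_density M X f"
    and pos: "AE w in lborel. w \<in> {0..<2*pi} \<longrightarrow> f w > 0"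
  shows "AE x in circ. C x \<noteq> 0"
proof -
  \<comment> \<open>Set integrability makes only the cut-off function measurable, not
    \<open>f\<close> on the whole line.\<close>
  define g where "g x = complex_of_real (indicator {0..<2*pi} x * f x)" for x
  have "integrable lborel (\<lambda>x. indicator {0..<2*pi} x * f x)"
    using f by (simp add: is_spectral_density_def set_integrable_def)
  then have ig: "integrable lborel g" unfolding g_def by (rule integrable_of_real)
  then have [measurable]: "g \<in> borel_measurable borel" by simp
  have g_ind: "indicator {0..<2*pi} x *\<^sub>R (h x * g x) = h x * g x" for x and h :: "real \<Rightarrow> complex"
    by (cases "x \<in> {0..<2*pi}") (simp_all add: g_def)
  have sC: "sq_int C" using C by (simp add: fourier_series_def)
  \<comment> \<open>The spectral density is taken with respect to Lebesgue measure, while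
    \<open>circ\<close> has total mass one; the factor \<open>2*pi\<close> converts between
    them.\<close>
  define v where "v = variance_Z / (2*pi)"
  have icC: "integrable circ (\<lambda>x. C x * cnj (C x))" by (intro sq_int_mult sq_int_cnj sC)
  have ig': "integrable circ g"
    using ig g_ind[of _ "\<lambda>_. 1"] by (simp add: integrable_circ_iff set_integrable_def)
  have "vanishing_fc (\<lambda>x. g x - of_real v * (C x * cnj (C x)))"
    unfolding vanishing_fc_def
  proof (intro conjI allI)
    show "integrable circ (\<lambda>x. g x - of_real v * (C x * cnj (C x)))"
      by (intro Bochner_Integration.integrable_diff integrable_mult_right ig' icC)
    fix t
    have "(\<integral>x. ech t x * g x \<partial>circ) = (\<integral>x. ech t x * g x \<partial>lborel) /\<^sub>R (2*pi)"
      by (simp add: integral_circ set_lebesgue_integral_def g_ind)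
    also have "(\<integral>x. ech t x * g x \<partial>lborel) = complex_of_real (cov2 M (X 0) (X t))"
      using f by (auto simp: is_spectral_density_def set_lebesgue_integral_def exp_eq_ech g_def
          intro!: Bochner_Integration.integral_cong split: split_indicator)
    finally have e1: "(\<integral>x. ech t x * g x \<partial>circ) = complex_of_real (cov2 M (X 0) (X t)) /\<^sub>R (2*pi)" .
    have "(\<lambda>n. of_real variance_Z * (\<Sum>k\<in>{- int n..int n}. of_real (c k) * cnj (of_real (c (k + t))))) \<longlonglongrightarrow>
        of_real variance_Z * (\<integral>x. ech t x * (C x * cnj (C x)) \<partial>circ)"
      by (intro tendsto_intros fourier_series_parseval C)
    moreover have "(\<lambda>n. of_real variance_Z * (\<Sum>k\<in>{- int n..int n}. of_real (c k) * cnj (of_real (c (k + t))))) \<longlonglongrightarrow>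
        complex_of_real (cov2 M (X 0) (X t))"
      using tendsto_of_real[OF cov2_tendsto[of t], where 'a = complex] by simp
    ultimately have e2: "of_real variance_Z * (\<integral>x. ech t x * (C x * cnj (C x)) \<partial>circ) = complex_of_real (cov2 M (X 0) (X t))"
      by (rule LIMSEQ_unique)
    have "integrable circ (\<lambda>x. ech t x * g x)" "integrable circ (\<lambda>x. ech t x * (C x * cnj (C x)))"
      by (intro integrable_bounded_mult[where C = 1] ig' icC; simp)+
    moreover have "ech t x * (g x - of_real v * (C x * cnj (C x))) = ech t x * g x - of_real v * (ech t x * (C x * cnj (C x)))" for x
      by (simp add: algebra_simps)
    ultimately have "(\<integral>x. ech t x * (g x - of_real v * (C x * cnj (C x))) \<partial>circ) =
        (\<integral>x. ech t x * g x \<partial>circ) - of_real v * (\<integral>x. ech t x * (C x * cnj (C x)) \<partial>circ)"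
      by simp
    also have "of_real v * (\<integral>x. ech t x * (C x * cnj (C x)) \<partial>circ) = complex_of_real (cov2 M (X 0) (X t)) /\<^sub>R (2*pi)"
      using e2 by (simp add: v_def scaleR_conv_of_real field_simps)
    finally show "(\<integral>x. ech t x * (g x - of_real v * (C x * cnj (C x))) \<partial>circ) = 0"
      by (simp add: e1)
  qed
  then have "AE x in circ. g x - of_real v * (C x * cnj (C x)) = 0" by (rule vanishing_fc_AE_0)
  moreover have "AE x in circ. 0 < x \<and> x < 2*pi" by (rule AE_circ_interior)
  moreover have "AE x in circ. f x > 0" using pos by (simp only: AE_circ_iff)
  ultimately show ?thesis by eventually_elim (auto simp: g_def)
qed

text \<open>With \<open>kappa = 0\<close> all third cumulants would vanish, and uniqueness in two
  variables would force the bispectrum to be zero almost everywhere.\<close>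

lemma kappa_nonzero:
  assumes B: "is_bispectrum M X B"
    and nz: "\<not> (AE w in lborel. w \<in> {0..<2*pi} \<times> {0..<2*pi} \<longrightarrow> B w = 0)"
  shows "kappa \<noteq> 0"
proof
  assume "kappa = 0"
  then have cum0: "cum3 M (X 0) (X t) (X s) = 0" for t s
    using cum3_tendsto[of t s] by (simp add: LIMSEQ_const_iff)
  define h where "h w = indicator ({0..<2*pi} \<times> {0..<2*pi}) w *\<^sub>R B w" for w
  have "AE w in lborel. h w = 0"
  proof (rule supported_AE_0_2d)
    show "integrable lborel h"
      using B by (simp add: is_bispectrum_def set_integrable_def h_def[abs_def])
    show "h p = 0" if "p \<notin> {0..<2*pi} \<times> {0..<2*pi}" for p
      using that by (simp add: h_def)
    fix t s
    have "(LINT w:{0..<2*pi} \<times> {0..<2*pi}|lborel.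
           exp (\<i> * (of_int t * complex_of_real (fst w) + of_int s * complex_of_real (snd w))) * B w) = 0"
      using B cum0[of t s] unfolding is_bispectrum_def by (metis of_real_0)
    then show "(\<integral>p. ech t (fst p) * ech s (snd p) * h p \<partial>lborel) = 0"
      by (simp add: set_lebesgue_integral_def exp_eq_ech2 h_def)
  qed
  then have "AE w in lborel. w \<in> {0..<2*pi} \<times> {0..<2*pi} \<longrightarrow> B w = 0"
    by eventually_elim (auto simp: h_def)
  with nz show False by blast
qed

end

text \<open>Conjugation reverses the signs of \<open>t\<close> and \<open>s\<close> in the
  exponentials and fixes a real \<open>B\<close>, while the cumulant itself is real.\<close>

lemma cum3_reflected:
  assumes B: "is_bispectrum M X B"
    and real: "AE w in lborel. w \<in> {0..<2*pi} \<times> {0..<2*pi} \<longrightarrow> Im (B w) = 0"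
  shows "cum3 M (X 0) (X (- t)) (X (- s)) = cum3 M (X 0) (X t) (X s)"
proof -
  let ?S = "{0..<2*pi} \<times> {0..<2*pi}"
  have eq: "complex_of_real (cum3 M (X 0) (X t) (X s)) =
      (\<integral>w. ech t (fst w) * ech s (snd w) * (indicator ?S w *\<^sub>R B w) \<partial>lborel)" for t s
    using B by (simp add: is_bispectrum_def set_lebesgue_integral_def exp_eq_ech2)
  have [measurable]: "(\<lambda>w. indicator ?S w *\<^sub>R B w) \<in> borel_measurable borel"
    using B by (auto simp: is_bispectrum_def set_integrable_def dest: borel_measurable_integrable)
  have [measurable]: "(\<lambda>w. ech t (fst w)) \<in> borel_measurable borel" "(\<lambda>w. ech t (snd w)) \<in> borel_measurable borel"
    for t and w :: "real \<times> real"
    by (intro measurable_compose[OF _ borel_measurable_ech] borel_measurable_continuous_onI continuous_intros)+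
  have "complex_of_real (cum3 M (X 0) (X (- t)) (X (- s))) =
      (\<integral>w. cnj (ech t (fst w) * ech s (snd w) * (indicator ?S w *\<^sub>R B w)) \<partial>lborel)"
    unfolding eq
  proof (rule integral_cong_AE)
    show "AE w in lborel. ech (- t) (fst w) * ech (- s) (snd w) * (indicator ?S w *\<^sub>R B w) =
        cnj (ech t (fst w) * ech s (snd w) * (indicator ?S w *\<^sub>R B w))"
      using real
    proof eventually_elim
      case (elim w)
      then show ?case
        by (cases "w \<in> ?S") (auto simp: ech_uminus complex_eq_iff)
    qed
  qed measurable
  also have "\<dots> = cnj (complex_of_real (cum3 M (X 0) (X t) (X s)))"
    unfolding eq by (rule Bochner_Integration.integral_cnj)
  finally show ?thesis by simp
qed

theorem theorem1:
  fixes M :: "'a measure" and X :: "int \<Rightarrow> 'a \<Rightarrow> real"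
    and f :: "real \<Rightarrow> real" and B :: "real \<times> real \<Rightarrow> complex"
  assumes "prob_space M"
    and "linear_ts M X"
    and "integrable M (\<lambda>\<omega>. \<bar>X 0 \<omega>\<bar> ^ 3)"
    and "is_spectral_density M X f"
    and "AE w in lborel. w \<in> {0..<2*pi} \<longrightarrow> f w > 0"
    and "is_bispectrum M X B"
    and "AE w in lborel. w \<in> {0..<2*pi} \<times> {0..<2*pi} \<longrightarrow> Im (B w) = 0"
    and "\<not> (AE w in lborel. w \<in> {0..<2*pi} \<times> {0..<2*pi} \<longrightarrow> B w = 0)"
  shows "reversible M X"
proof -
  interpret prob_space M by fact
  from \<open>linear_ts M X\<close> obtain c Z where
    "\<forall>t. X t \<in> borel_measurable M" "(\<lambda>k. (c k)\<^sup>2) summable_on UNIV"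
    "indep_vars (\<lambda>_. borel) Z UNIV" "\<forall>t. distr M borel (Z t) = distr M borel (Z 0)"
    "integrable M (\<lambda>\<omega>. (Z 0 \<omega>)\<^sup>2)" "expectation (Z 0) = 0"
    "\<forall>t. AE \<omega> in M. (\<lambda>n. \<Sum>k\<in>{- int n..int n}. c k * Z (t - k) \<omega>) \<longlonglongrightarrow> X t \<omega>"
    unfolding linear_ts_def by blast
  then interpret moving_average M Z c X
    by unfold_locales auto
  show ?thesis
  \<comment> \<open>If all coefficients vanish, \<open>X\<close> carries no information about the
    third moment of \<open>Z\<close>; reversibility is then immediate because \<open>X\<close> is
    almost surely zero.\<close>
  proof (cases "\<exists>k. c k \<noteq> 0")
    case False
    then have X0: "AE \<omega> in M. X t \<omega> = 0" for t
      using X_lim[of t] by (auto simp: LIMSEQ_const_iff)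
    show ?thesis
      unfolding reversible_def
    proof (intro allI distr_cong_AE)
      fix k :: nat and t :: int
      have "AE \<omega> in M. \<forall>i::nat. X (t + int i) \<omega> = 0 \<and> X (t + int k - int i) \<omega> = 0"
        unfolding AE_all_countable using X0 by simp
      then show "AE \<omega> in M. (\<lambda>i\<in>{..k}. X (t + int i) \<omega>) = (\<lambda>i\<in>{..k}. X (t + int k - int i) \<omega>)"
        by eventually_elim (simp add: restrict_def)
    qed measurable
  next
    case True
    then obtain k0 where "c k0 \<noteq> 0" by blast
    with \<open>integrable M (\<lambda>\<omega>. \<bar>X 0 \<omega>\<bar> ^ 3)\<close> have "integrable M (\<lambda>\<omega>. \<bar>Z 0 \<omega>\<bar> ^ 3)"
      by (rule Z_cube_integrable)
    then interpret moving_average_cube M Z c X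
      by unfold_locales
    obtain C where C: "fourier_series (\<lambda>k. of_real (c k)) C"
      using fourier_series_exists[of "\<lambda>k. complex_of_real (c k)"] c_summable by auto
    have C0: "AE x in circ. C x \<noteq> 0"
      by (rule transfer_function_nonzero) fact+
    have kappa: "kappa \<noteq> 0"
      by (rule kappa_nonzero) fact+
    have "\<exists>m. \<forall>j. c (m - j) = c j"
    proof (rule reflection_of_triple_correlation[OF c_summable C C0])
      \<comment> \<open>Division by \<open>kappa\<close> turns third cumulants into triple
        correlations of \<open>c\<close>.\<close>
      show "(\<lambda>n. \<Sum>j\<in>{- int n..int n}. c j * c (j + t) * c (j + s)) \<longlonglongrightarrow> cum3 M (X 0) (X t) (X s) / kappa" for t s
        using tendsto_divide[OF cum3_tendsto[of t s] tendsto_const kappa] kappa by simp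
      show "cum3 M (X 0) (X (- t)) (X (- s)) / kappa = cum3 M (X 0) (X t) (X s) / kappa" for t s
        using cum3_reflected[OF \<open>is_bispectrum M X B\<close>
            \<open>AE w in lborel. w \<in> {0..<2*pi} \<times> {0..<2*pi} \<longrightarrow> Im (B w) = 0\<close>] by simp
    qed
    then show ?thesis using reversible_of_reflection by blast
  qed
qed

end
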